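(* Let $q$ be a prime power and $n\ge 1$. For all integers $m,d\geq 1$ and every $G\in\{\mathrm{GL}(n,\mathbb{F}_q),\mathrm{SL}(n,\mathbb{F}_q),\mathrm{U}(n,\mathbb{F}_q)\}$ with standard representation $W$, there exist $(m+d)n$ invariant polynomials $\ell_1,\ell_2,\dots,\ell_{(m+d)n}\in\mathbb{F}_q[mW\oplus dW^*]^G$ such that $$\mathbb{F}_q(mW\oplus dW^* )^G=\mathbb{F}_q(\ell_1,\ell_2,\dots,\ell_{(m+d)n}).$$
   Context: $\mathbb{F}_q$ is the finite field with $q$ elements. $\mathrm{U}(n,\mathbb{F}_q)$ is the group of upper triangular $n\times n$ matrices over $\mathbb{F}_q$ with $1$'s on the diagonal. $W$ is the standard $n$-dimensional representation of $G$, $W^*$ is its dual, and $mW\oplus dW^*$ is the direct sum of $m$ copies of $W$ and $d$ copies of $W^*$. Concretely, $\mathbb{F}_q[mW\oplus dW^*]$ is the polynomial ring over $\mathbb{F}_q$ in the $(m+d)n$ variables $x_{ji}$ ($1\le j\le m$, $1\le i\le n$) and $y_{ki}$ ($1\le k\le d$, $1\le i\le n$), on which $\sigma=(\sigma_{ab})\in G$ acts by the $\mathbb{F}_q$-algebra automorphism with $\sigma(x_{ji})=\sum_{a=1}^n\sigma_{ai}x_{ja}$ and $\sigma(y_{ki})=\sum_{a=1}^n(\sigma^{-1})_{ia}y_{ka}$ (so the $x_{j\cdot}$ and the $y_{k\cdot}$ transform as dual bases). $\mathbb{F}_q(mW\oplus dW^* )$ is its fraction field, with the induced action. Superscript $G$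 denotes the ring (resp. field) of elements fixed by all of $G$. *)

theory Defs
  imports
    "HOL-Library.Poly_Mapping"
    "HOL-Library.Countable"
    "HOL-Computational_Algebra.Fraction_Field"
    "HOL-Algebra.Generated_Fields"
    "HOL-Algebra.Algebraic_Closure_Type"
    "Jordan_Normal_Form.Determinant"
begin

section \<open>The polynomial ring and its fraction field\<close>

text \<open>
  \<open>xv j i\<close> and \<open>yv k i\<close> stand for $x_{ji}$ and $y_{ki}$, the generators belonging to the \<open>j\<close>-th copy of
  \<open>W\<close> and the \<open>k\<close>-th copy of \<open>W*\<close>. All indices start at 0, as in the matrix library.
\<close>

datatype var = xv nat nat | yv nat nat

instance var :: countable
  by countable_datatype

text \<open>
  The linear order on variables has no mathematical role; it is what the library
  requires to know that the polynomials form an integral domain.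
\<close>

instantiation var :: linorder
begin

definition "(v :: var) \<le> w \<longleftrightarrow> to_nat v \<le> to_nat w"
definition "(v :: var) < w \<longleftrightarrow> to_nat v < to_nat w"

instance
  by standard (auto simp: less_eq_var_def less_var_def)

end

type_synonym 'a mpoly = "(var \<Rightarrow>\<^sub>0 nat) \<Rightarrow>\<^sub>0 'a"

definition Const :: "'a::field \<Rightarrow> 'a mpoly" where
  "Const c = Poly_Mapping.single 0 c"

definition Var :: "var \<Rightarrow> 'a::field mpoly" where
  "Var v = Poly_Mapping.single (Poly_Mapping.single v 1) 1"

definition subst_monom :: "(var \<Rightarrow> 'a::field mpoly) \<Rightarrow> (var \<Rightarrow>\<^sub>0 nat) \<Rightarrow> 'a mpoly" where
  "subst_monom f t = (\<Prod>v\<in>Poly_Mapping.keys t. f v ^ Poly_Mapping.lookup t v)"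

definition subst :: "(var \<Rightarrow> 'a::field mpoly) \<Rightarrow> 'a mpoly \<Rightarrow> 'a mpoly" where
  "subst f p = (\<Sum>t\<in>Poly_Mapping.keys p. Const (Poly_Mapping.lookup p t) * subst_monom f t)"

text \<open>The ring \<open>F\<^sub>q[mW \<oplus> dW*]\<close>: only the variables with \<open>j < m\<close>, \<open>k < d\<close>, \<open>i < n\<close> may occur.\<close>

definition var_set :: "nat \<Rightarrow> nat \<Rightarrow> nat \<Rightarrow> var set" where
  "var_set n m d = {xv j i |j i. j < m \<and> i < n} \<union> {yv k i |k i. k < d \<and> i < n}"

definition poly_ring :: "nat \<Rightarrow> nat \<Rightarrow> nat \<Rightarrow> 'a::field mpoly set" where
  "poly_ring n m d = {p. \<forall>t\<in>Poly_Mapping.keys p. Poly_Mapping.keys t \<subseteq> var_set n m d}"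

definition rat_field :: "nat \<Rightarrow> nat \<Rightarrow> nat \<Rightarrow> 'a::field mpoly fract set" where
  "rat_field n m d = {Fract p r |p r. p \<in> poly_ring n m d \<and> r \<in> poly_ring n m d \<and> r \<noteq> 0}"


section \<open>The matrix groups\<close>

definition GL :: "nat \<Rightarrow> 'a::field mat set" where
  "GL n = {A \<in> carrier_mat n n. invertible_mat A}"

definition SL :: "nat \<Rightarrow> 'a::field mat set" where
  "SL n = {A \<in> carrier_mat n n. det A = 1}"

definition UT :: "nat \<Rightarrow> 'a::field mat set" where
  "UT n = {A \<in> carrier_mat n n. upper_triangular A \<and> (\<forall>i<n. A $$ (i, i) = 1)}"


section \<open>The action\<close>

text \<open>
  The action is defined on the variables of all copies of \<open>W\<close> and \<open>W*\<close> at once; variables whose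
  second index is out of range are fixed, so that every element of \<open>GL n\<close> acts by an
  automorphism of the whole polynomial ring.
\<close>

definition act_var :: "nat \<Rightarrow> 'a::field mat \<Rightarrow> var \<Rightarrow> 'a mpoly" where
  "act_var n \<sigma> v = (case v of
      xv j i \<Rightarrow> if i < n then \<Sum>a<n. Const (\<sigma> $$ (a, i)) * Var (xv j a) else Var v
    | yv k i \<Rightarrow> if i < n
        then \<Sum>a<n. Const ((inv\<^bsub>ring_mat TYPE('a) n ()\<^esub> \<sigma>) $$ (i, a)) * Var (yv k a)
        else Var v)"

definition act :: "nat \<Rightarrow> 'a::field mat \<Rightarrow> 'a mpoly \<Rightarrow> 'a mpoly" where
  "act n \<sigma> = subst (act_var n \<sigma>)"

text \<open>
  The map induced on fractions by an injective ring endomorphism; see \<open>act_fract_Fract\<close> below.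
\<close>

definition induced :: "('r::idom \<Rightarrow> 'r) \<Rightarrow> 'r fract \<Rightarrow> 'r fract" where
  "induced \<phi> z = (THE w. \<forall>p r. r \<noteq> 0 \<longrightarrow> z = Fract p r \<longrightarrow> w = Fract (\<phi> p) (\<phi> r))"

definition act_fract :: "nat \<Rightarrow> 'a::field mat \<Rightarrow> 'a mpoly fract \<Rightarrow> 'a mpoly fract" where
  "act_fract n \<sigma> = induced (act n \<sigma>)"

definition invariant_ring :: "'a::field mat set \<Rightarrow> nat \<Rightarrow> nat \<Rightarrow> nat \<Rightarrow> 'a mpoly set" where
  "invariant_ring G n m d = {p \<in> poly_ring n m d. \<forall>\<sigma>\<in>G. act n \<sigma> p = p}"

definition invariant_field :: "'a::field mat set \<Rightarrow> nat \<Rightarrow> nat \<Rightarrow> nat \<Rightarrow> 'a mpoly fract set" where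
  "invariant_field G n m d = {z \<in> rat_field n m d. \<forall>\<sigma>\<in>G. act_fract n \<sigma> z = z}"

definition adjoin :: "'a::field mpoly set \<Rightarrow> 'a mpoly fract set" where
  "adjoin S = generate_field ring_of_type_algebra
     ((\<lambda>c. Fract (Const c) 1) ` UNIV \<union> (\<lambda>p. Fract p 1) ` S)"


section \<open>The action is well defined\<close>

lemma Const_0: "Const 0 = 0" and Const_1: "Const 1 = 1"
  and Const_add: "Const (a + b) = Const a + Const b"
  and Const_mult: "Const (a * b) = Const a * Const b"
  by (simp_all add: Const_def single_add mult_single)

lemma Const_sum: "Const (sum f A) = (\<Sum>x\<in>A. Const (f x))"
  by (induction A rule: infinite_finite_induct) (simp_all add: Const_0 Const_add)

lemma subst_monom_superset:
  assumes "finite A" "Poly_Mapping.keys t \<subseteq> A"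
  shows "subst_monom f t = (\<Prod>v\<in>A. f v ^ Poly_Mapping.lookup t v)"
  unfolding subst_monom_def
  by (rule prod.mono_neutral_left) (use assms in \<open>auto simp: in_keys_iff\<close>)

lemma subst_monom_add: "subst_monom f (s + t) = subst_monom f s * subst_monom f t"
proof -
  let ?A = "Poly_Mapping.keys s \<union> Poly_Mapping.keys t"
  have "Poly_Mapping.keys (s + t) \<subseteq> ?A" by (rule Poly_Mapping.keys_add)
  thus ?thesis
    by (subst (1 2 3) subst_monom_superset[of ?A])
       (auto simp: lookup_add power_add prod.distrib)
qed

lemma subst_superset:
  assumes "finite A" "Poly_Mapping.keys p \<subseteq> A"
  shows "subst f p = (\<Sum>t\<in>A. Const (Poly_Mapping.lookup p t) * subst_monom f t)"
  unfolding subst_def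
  by (rule sum.mono_neutral_left) (use assms in \<open>auto simp: in_keys_iff Const_0\<close>)

lemma subst_add: "subst f (p + r) = subst f p + subst f r"
proof -
  let ?A = "Poly_Mapping.keys p \<union> Poly_Mapping.keys r"
  have "Poly_Mapping.keys (p + r) \<subseteq> ?A" by (rule Poly_Mapping.keys_add)
  thus ?thesis
    by (subst (1 2 3) subst_superset[of ?A])
       (auto simp: lookup_add Const_add distrib_right sum.distrib)
qed

lemma subst_0: "subst f 0 = 0"
  by (simp add: subst_def)

lemma subst_single: "subst f (Poly_Mapping.single t c) = Const c * subst_monom f t"
  by (subst subst_superset[of "{t}"]) auto

lemma subst_Const: "subst f (Const c) = Const c"
  using subst_single[of f 0 c] by (simp add: Const_def subst_monom_def)

lemma subst_Var: "subst f (Var v) = f v"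
  unfolding Var_def by (subst subst_single) (simp add: Const_1 subst_monom_def)

lemma sum_single_lookup:
  "(\<Sum>t\<in>Poly_Mapping.keys p. Poly_Mapping.single t (Poly_Mapping.lookup p t)) = p"
  by (rule poly_mapping_eqI)
     (auto simp: lookup_sum lookup_single when_def in_keys_iff)

lemma poly_mapping_single_induct:
  fixes p :: "'k \<Rightarrow>\<^sub>0 'b::comm_monoid_add"
  assumes "P 0" "\<And>t c. P (Poly_Mapping.single t c)" "\<And>p r. P p \<Longrightarrow> P r \<Longrightarrow> P (p + r)"
  shows "P p"
proof -
  have "P (\<Sum>t\<in>A. Poly_Mapping.single t (Poly_Mapping.lookup p t))" for A
    by (induction A rule: infinite_finite_induct) (auto intro: assms)
  thus ?thesis by (metis sum_single_lookup)
qed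

lemma subst_mult: "subst f (p * r) = subst f p * subst f r"
proof (induction p rule: poly_mapping_single_induct)
  case (2 t c)
  show ?case
  proof (induction r rule: poly_mapping_single_induct)
    case (2 t' c')
    show ?case
      by (simp add: mult_single subst_single Const_mult subst_monom_add algebra_simps)
  qed (simp_all add: subst_0 subst_add distrib_left)
qed (simp_all add: subst_0 subst_add distrib_right)

lemma subst_sum: "subst f (sum g A) = (\<Sum>x\<in>A. subst f (g x))"
  by (induction A rule: infinite_finite_induct) (simp_all add: subst_0 subst_add)

lemma subst_prod_power:
  "subst f (\<Prod>v\<in>A. g v ^ e v) = (\<Prod>v\<in>A. subst f (g v) ^ e v)"
proof -
  have one: "subst f 1 = 1" using subst_Const[of f 1] by (simp add: Const_1)
  have pow: "subst f (h ^ k) = subst f h ^ k" for h k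
    by (induction k) (simp_all add: one subst_mult)
  show ?thesis
    by (induction A rule: infinite_finite_induct) (simp_all add: one subst_mult pow)
qed

lemma subst_subst: "subst f (subst g p) = subst (\<lambda>v. subst f (g v)) p"
  unfolding subst_def[of g] subst_def[of "\<lambda>v. subst f (g v)"]
  by (simp add: subst_sum subst_mult subst_Const subst_monom_def subst_prod_power)

lemma subst_monom_Var: "subst_monom Var t = (Poly_Mapping.single t 1 :: 'a::field mpoly)"
proof -
  have pow: "Var v ^ k = (Poly_Mapping.single (Poly_Mapping.single v k) 1 :: 'a mpoly)" for v k
    by (induction k) (simp_all add: Var_def mult_single single_add[symmetric])
  have "(\<Prod>v\<in>A. Poly_Mapping.single (g v) 1) = (Poly_Mapping.single (sum g A) 1 :: 'a mpoly)"
    for g and A :: "var set"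
    by (induction A rule: infinite_finite_induct) (simp_all add: mult_single)
  thus ?thesis
    by (simp add: subst_monom_def pow sum_single_lookup)
qed

lemma subst_Var_id: "subst Var p = p"
  by (simp add: subst_def subst_monom_Var Const_def mult_single sum_single_lookup)

lemma GL_Units: "GL n = Units (ring_mat TYPE('a::field) n ())"
proof (intro equalityI subsetI)
  fix A :: "'a mat" assume "A \<in> GL n"
  then obtain B where A: "A \<in> carrier_mat n n" and B: "A * B = 1\<^sub>m n" "B * A = 1\<^sub>m (dim_row B)"
    by (auto simp: GL_def invertible_mat_def inverts_mat_def)
  have "dim_col B = n" using arg_cong[OF B(1), of dim_col] by simp
  moreover have "dim_row B = n" using arg_cong[OF B(2), of dim_col] A by simp
  ultimately have "B \<in> carrier_mat n n" by auto
  with A B show "A \<in> Units (ring_mat TYPE('a) n ())"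
    by (auto simp: Units_def ring_mat_simps)
next
  fix A :: "'a mat" assume "A \<in> Units (ring_mat TYPE('a) n ())"
  thus "A \<in> GL n"
    by (auto simp: Units_def ring_mat_simps GL_def invertible_mat_def inverts_mat_def)
qed

lemma SL_subset_GL: "SL n \<subseteq> GL n"
  by (auto simp: GL_Units SL_def intro: det_non_zero_imp_unit)

lemma UT_subset_SL: "UT n \<subseteq> SL n"
proof
  fix A :: "'a mat" assume A: "A \<in> UT n"
  hence "det A = prod_list (diag_mat A)"
    by (intro det_upper_triangular) (auto simp: UT_def)
  also have "diag_mat A = replicate n 1"
    using A by (auto simp: UT_def diag_mat_def intro!: nth_equalityI)
  finally show "A \<in> SL n" using A by (simp add: UT_def SL_def)
qed

text \<open>This is a left action.\<close>

lemma act_act: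
  fixes \<sigma> \<tau> :: "'a::field mat"
  assumes "\<sigma> \<in> GL n" "\<tau> \<in> GL n"
  shows "act n \<sigma> (act n \<tau> p) = act n (\<sigma> * \<tau>) p"
proof -
  let ?R = "ring_mat TYPE('a) n ()"
  interpret R: ring ?R by (rule ring_mat)
  have U: "\<sigma> \<in> Units ?R" "\<tau> \<in> Units ?R" using assms by (auto simp: GL_Units)
  have inv: "inv\<^bsub>?R\<^esub> (\<sigma> * \<tau>) = inv\<^bsub>?R\<^esub> \<tau> * inv\<^bsub>?R\<^esub> \<sigma>"
  proof -
    let ?\<sigma>' = "inv\<^bsub>?R\<^esub> \<sigma>" and ?\<tau>' = "inv\<^bsub>?R\<^esub> \<tau>"
    note c = R.Units_closed[OF U(1)] R.Units_closed[OF U(2)]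
      R.Units_inv_closed[OF U(1)] R.Units_inv_closed[OF U(2)]
    have "(\<sigma> \<otimes>\<^bsub>?R\<^esub> \<tau>) \<otimes>\<^bsub>?R\<^esub> (?\<tau>' \<otimes>\<^bsub>?R\<^esub> ?\<sigma>') = \<sigma> \<otimes>\<^bsub>?R\<^esub> ((\<tau> \<otimes>\<^bsub>?R\<^esub> ?\<tau>') \<otimes>\<^bsub>?R\<^esub> ?\<sigma>')"
      using c by (simp add: R.m_assoc del: R.Units_r_inv R.Units_l_inv)
    moreover have "(?\<tau>' \<otimes>\<^bsub>?R\<^esub> ?\<sigma>') \<otimes>\<^bsub>?R\<^esub> (\<sigma> \<otimes>\<^bsub>?R\<^esub> \<tau>) = ?\<tau>' \<otimes>\<^bsub>?R\<^esub> ((?\<sigma>' \<otimes>\<^bsub>?R\<^esub> \<sigma>) \<otimes>\<^bsub>?R\<^esub> \<tau>)"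
      using c by (simp add: R.m_assoc del: R.Units_r_inv R.Units_l_inv)
    ultimately have "?\<tau>' \<otimes>\<^bsub>?R\<^esub> ?\<sigma>' = inv\<^bsub>?R\<^esub> (\<sigma> \<otimes>\<^bsub>?R\<^esub> \<tau>)"
      using c U by (intro R.inv_unique') simp_all
    thus ?thesis by (simp add: ring_mat_simps)
  qed
  have entry: "(A * B) $$ (i, k) = (\<Sum>a<n. A $$ (i, a) * B $$ (a, k))"
    if "A \<in> carrier_mat n n" "B \<in> carrier_mat n n" "i < n" "k < n" for A B :: "'a mat" and i k
    using that by (auto simp: scalar_prod_def atLeast0LessThan intro!: sum.cong)
  have car: "\<sigma> \<in> carrier_mat n n" "\<tau> \<in> carrier_mat n n"
    "inv\<^bsub>?R\<^esub> \<sigma> \<in> carrier_mat n n" "inv\<^bsub>?R\<^esub> \<tau> \<in> carrier_mat n n"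
    using U R.Units_closed R.Units_inv_closed by (auto simp: ring_mat_simps)
  have "subst (act_var n \<sigma>) (act_var n \<tau> v) = act_var n (\<sigma> * \<tau>) v" for v
  proof (cases v)
    case (xv j i)
    show ?thesis
    proof (cases "i < n")
      case True
      have "subst (act_var n \<sigma>) (act_var n \<tau> v) =
          (\<Sum>a<n. \<Sum>b<n. Const (\<tau> $$ (a, i)) * (Const (\<sigma> $$ (b, a)) * Var (xv j b)))"
        using True xv
        by (simp add: act_var_def[of n \<tau>] subst_sum subst_mult subst_Const subst_Var)
           (simp add: act_var_def sum_distrib_left)
      also have "\<dots> = (\<Sum>b<n. \<Sum>a<n. Const (\<tau> $$ (a, i)) * (Const (\<sigma> $$ (b, a)) * Var (xv j b)))"
        by (rule sum.swap)
      also have "\<dots> = (\<Sum>b<n. Const ((\<sigma> * \<tau>) $$ (b, i)) * Var (xv j b))"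
        using True car
        by (intro sum.cong refl)
           (auto simp: entry Const_sum Const_mult sum_distrib_left sum_distrib_right mult_ac
             simp del: index_mult_mat)
      finally show ?thesis using True xv by (simp add: act_var_def)
    qed (simp add: xv act_var_def subst_Var)
  next
    case (yv k i)
    show ?thesis
    proof (cases "i < n")
      case True
      have "subst (act_var n \<sigma>) (act_var n \<tau> v) =
          (\<Sum>a<n. \<Sum>b<n. Const ((inv\<^bsub>?R\<^esub> \<tau>) $$ (i, a)) *
            (Const ((inv\<^bsub>?R\<^esub> \<sigma>) $$ (a, b)) * Var (yv k b)))"
        using True yv
        by (simp add: act_var_def[of n \<tau>] subst_sum subst_mult subst_Const subst_Var)
           (simp add: act_var_def sum_distrib_left)
      also have "\<dots> = (\<Sum>b<n. \<Sum>a<n. Const ((inv\<^bsub>?R\<^esub> \<tau>) $$ (i, a)) *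
            (Const ((inv\<^bsub>?R\<^esub> \<sigma>) $$ (a, b)) * Var (yv k b)))"
        by (rule sum.swap)
      also have "\<dots> = (\<Sum>b<n. Const ((inv\<^bsub>?R\<^esub> (\<sigma> * \<tau>)) $$ (i, b)) * Var (yv k b))"
        using True car
        by (intro sum.cong refl)
           (auto simp: inv entry Const_sum Const_mult sum_distrib_left sum_distrib_right mult_ac
             simp del: index_mult_mat)
      finally show ?thesis using True yv by (simp add: act_var_def)
    qed (simp add: yv act_var_def subst_Var)
  qed
  thus ?thesis by (simp add: act_def subst_subst)
qed

lemma act_one: "act n (1\<^sub>m n) p = (p :: 'a::field mpoly)"
proof -
  let ?R = "ring_mat TYPE('a) n ()"
  interpret R: ring ?R by (rule ring_mat)
  have inv: "inv\<^bsub>?R\<^esub> (1\<^sub>m n) = 1\<^sub>m n"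
    using R.inv_one by (simp add: ring_mat_simps)
  have "(\<Sum>a<n. Const ((1\<^sub>m n :: 'a mat) $$ (a, i)) * Var (g a)) = Var (g i)"
    "(\<Sum>a<n. Const ((1\<^sub>m n :: 'a mat) $$ (i, a)) * Var (g a)) = Var (g i)"
    if "i < n" for i and g :: "nat \<Rightarrow> var"
    using that
    by (simp_all add: if_distrib[of Const] if_distrib[of "\<lambda>c. c * _"] Const_0 Const_1 cong: if_cong)
  hence "act_var n (1\<^sub>m n :: 'a mat) = Var"
    by (auto simp: act_var_def inv fun_eq_iff split: var.splits)
  thus ?thesis by (simp add: act_def subst_Var_id)
qed

lemma act_eq_0_iff:
  fixes \<sigma> :: "'a::field mat"
  assumes "\<sigma> \<in> GL n"
  shows "act n \<sigma> p = 0 \<longleftrightarrow> p = 0"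
proof
  let ?R = "ring_mat TYPE('a) n ()"
  interpret R: ring ?R by (rule ring_mat)
  have U: "\<sigma> \<in> Units ?R" using assms by (simp add: GL_Units)
  assume "act n \<sigma> p = 0"
  hence "act n (inv\<^bsub>?R\<^esub> \<sigma>) (act n \<sigma> p) = 0"
    by (simp add: act_def subst_0)
  moreover have "inv\<^bsub>?R\<^esub> \<sigma> * \<sigma> = 1\<^sub>m n"
    using R.Units_l_inv[OF U] by (simp add: ring_mat_simps)
  moreover have "inv\<^bsub>?R\<^esub> \<sigma> \<in> GL n"
    using R.Units_inv_Units[OF U] by (simp add: GL_Units)
  ultimately show "p = 0" using assms by (simp add: act_act act_one)
qed (simp add: act_def subst_0)

lemma induced_Fract:
  assumes "\<And>a b. \<phi> (a * b) = \<phi> a * \<phi> b" "\<And>a. \<phi> a = 0 \<longleftrightarrow> a = 0" "r \<noteq> 0"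
  shows "induced \<phi> (Fract p r) = Fract (\<phi> p) (\<phi> r)"
  unfolding induced_def
proof (rule the_equality)
  show "\<forall>p' r'. r' \<noteq> 0 \<longrightarrow> Fract p r = Fract p' r' \<longrightarrow> Fract (\<phi> p) (\<phi> r) = Fract (\<phi> p') (\<phi> r')"
    using assms by (auto simp: eq_fract(1) simp flip: assms(1))
qed (use assms in blast)

lemma act_fract_Fract:
  assumes "\<sigma> \<in> GL n" "r \<noteq> 0"
  shows "act_fract n \<sigma> (Fract p r) = Fract (act n \<sigma> p) (act n \<sigma> r)"
  unfolding act_fract_def using assms
  by (intro induced_Fract) (simp_all add: act_eq_0_iff, simp add: act_def subst_mult)

end

theory Submission
  imports
    Defs
    "HOL-Library.Cardinality"
    "HOL-Computational_Algebra.Polynomial_Factorial"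
    "Jordan_Normal_Form.Char_Poly"
begin

text \<open>
Write $q$ for the order of the field, $x_0,\dots,x_{n-1}$ for the variables \<open>xv 0 i\<close> of the first copy
of \<open>W\<close>, $V_i$ for the $F_q$-span of $x_0,\dots,x_{i-1}$, and \<open>K\<close> for the field generated by the
proposed invariants. There are \<open>n\<close> generators for each of the \<open>m + d\<close> copies.

The generators for all copies but the first are the same for the three groups. The Moore matrix
$M = (x_i^{q^r})_{r,i}$ is multiplied by \<open>\<sigma>\<close> from the right when \<open>\<sigma>\<close> acts, because \<open>c \<mapsto> c\<^sup>q\<close> is the
identity on the field; its determinant \<open>D\<close> is not zero and is multiplied by \<open>det \<sigma>\<close>. Hence the
entries of $M y_k$ (\<open>twisted_pairing\<close>) and of $D^{q-2}\, x_j\, \mathrm{adj}(M)$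
(\<open>moore_coordinate\<close>) are invariant polynomials, and inverting \<open>M\<close> expresses the variables $y_k$ and
$x_j$ through them with coefficients in $K[x_0,\dots,x_{n-1}]$, as soon as $D^{q-1} \in K$. Since a
rational invariant can be written with an invariant numerator and an invariant denominator
(\<open>invariant_field_subset\<close>), the theorem reduces to the claim that the invariant elements of
$K[x_0,\dots,x_{n-1}]$ lie in \<open>K\<close> (\<open>invariant_field_eq_adjoin\<close>); the element $D^{q-1}$ is one of
them, so that the condition on it is a case of the claim.

The claim is proved by descent through the rings $R_i = K[x_0,\dots,x_{i-1}]$ (\<open>tower_descent\<close>).
Let \<open>z\<close> be an invariant in $R_{i+1}$, say $z = P(x_i)$ with $P \in R_i[T]$. Whenever some
\<open>\<sigma> \<in> G\<close> fixes $x_0,\dots,x_{i-1}$ and maps $x_i$ to \<open>s\<close>, also $P(s) = z$. A polynomial that takes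
one value this often is constant modulo the polynomial that has all these \<open>s\<close> as roots, so
$z \in R_i$; \<open>constant_value_in_subring\<close> is the precise form.
For unitriangular matrices \<open>s\<close> runs through $x_i + V_i$, the roots of
$\prod_{v \in V_i}(T - v) - N_i$ where $N_i$ is the product of the coset $x_i + V_i$; the $N_i$ are the
generators for the first copy. For \<open>GL\<close> the values are the elements of $V_n$ outside $V_i$,
which are roots of $\prod_{v \in V_n}(T - v)$. This polynomial contains only the powers $T^{q^r}$
(\<open>dickson_poly_eq\<close>), so that its \<open>n\<close> coefficients with \<open>r < n\<close>, the Dickson invariants, serve as
generators for the first copy.

For \<open>SL\<close> the Dickson invariant of index 0, which is $\pm D^{q-1}$ (\<open>dickson_0\<close>), is replaced by \<open>D\<close>.
The quotient of \<open>GL\<close> by \<open>SL\<close> is the group of nonzero scalars, of order prime to the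
characteristic, so an \<open>SL\<close>-invariant is a sum of components on which \<open>GL\<close> acts through
$\det^k$. Such a component is $D^k$ times a \<open>GL\<close>-invariant (\<open>SL_field_from_GL_field\<close>).
\<close>

section \<open>Power maps over a finite field\<close>

lemma finite_field_power_card_minus_1:
  fixes c :: "'a::{field,finite}"
  assumes "c \<noteq> 0"
  shows "c ^ (CARD('a) - 1) = 1"
proof -
  let ?S = "UNIV - {0::'a}"
  have "bij_betw (\<lambda>x. c * x) ?S ?S"
    by (rule bij_betw_byWitness[where f' = "\<lambda>x. x / c"]) (use assms in auto)
  hence "(\<Prod>x\<in>?S. c * x) = (\<Prod>x\<in>?S. x)"
    by (rule prod.reindex_bij_betw)
  moreover have "(\<Prod>x\<in>?S. c * x) = c ^ (CARD('a) - 1) * (\<Prod>x\<in>?S. x)"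
    by (simp add: prod.distrib card_Diff_singleton)
  moreover have "(\<Prod>x\<in>?S. x) \<noteq> 0" by simp
  ultimately show ?thesis by simp
qed

lemma card_field_ge_2: "2 \<le> CARD('a::{field,finite})"
proof -
  have "card {0, 1 :: 'a} \<le> CARD('a)" by (intro card_mono) auto
  thus ?thesis by simp
qed

lemma finite_field_power_card: "(c :: 'a::{field,finite}) ^ CARD('a) = c"
proof (cases "c = 0")
  case False
  have "c ^ CARD('a) = c ^ Suc (CARD('a) - 1)"
    using card_field_ge_2[where 'a='a] by (intro arg_cong[where f = "power c"]) simp
  also have "\<dots> = c * c ^ (CARD('a) - 1)" by (rule power_Suc)
  also have "\<dots> = c" using finite_field_power_card_minus_1[OF False] by simp
  finally show ?thesis .
qed (use card_field_ge_2[where 'a='a] in auto)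

text \<open>
The polynomial $(X + 1)^q - X^q - 1$ has degree less than \<open>q\<close> and vanishes on the whole field, because
the \<open>q\<close>-th power map is the identity there. So it is zero, and its coefficients are the
binomial coefficients in question.
\<close>

lemma binomial_card_finite_field:
  assumes "0 < k" "k < CARD('a)"
  shows "of_nat (CARD('a::{field,finite}) choose k) = (0 :: 'a)"
proof -
  let ?q = "CARD('a)"
  let ?p = "\<Sum>k\<in>{1..<?q}. Polynomial.monom (of_nat (?q choose k) :: 'a) k"
  have q: "?q \<ge> 2" by (rule card_field_ge_2)
  have "poly ?p x = poly 0 x" for x
  proof -
    have "x + 1 = (x + 1) ^ ?q" by (simp add: finite_field_power_card)
    also have "\<dots> = (\<Sum>k\<le>?q. of_nat (?q choose k) * x ^ k)"
      by (simp add: binomial_ring)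
    also have "{..?q} = insert 0 (insert ?q {1..<?q})" using q by auto
    also have "(\<Sum>k\<in>\<dots>. of_nat (?q choose k) * x ^ k) = 1 + (x + (\<Sum>k\<in>{1..<?q}. of_nat (?q choose k) * x ^ k))"
      using q by (subst sum.insert, simp, simp, subst sum.insert)
        (simp_all add: finite_field_power_card)
    finally show ?thesis by (simp add: poly_sum poly_monom)
  qed
  moreover have "degree ?p < ?q"
    using q by (intro degree_sum_less) (auto intro: le_less_trans[OF degree_monom_le])
  ultimately have "?p = 0"
    by (intro poly_eqI_degree[where A = UNIV]) (use q in auto)
  hence "Polynomial.coeff ?p k = 0" by simp
  thus ?thesis using assms by (simp add: Polynomial.coeff_sum)
qed

lemma of_nat_mpoly: "(of_nat k :: 'a::field mpoly) = Const (of_nat k)"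
  by (induction k) (simp_all add: Const_0 Const_1 Const_add)

lemma Const_power: "Const (c ^ k) = Const c ^ k"
  by (induction k) (simp_all add: Const_1 Const_mult)

lemma mpoly_power_card_add:
  fixes u v :: "'a::{field,finite} mpoly"
  shows "(u + v) ^ CARD('a) = u ^ CARD('a) + v ^ CARD('a)"
proof -
  let ?q = "CARD('a)"
  have q: "?q \<ge> 2" by (rule card_field_ge_2)
  have "(u + v) ^ ?q = (\<Sum>k\<le>?q. of_nat (?q choose k) * u ^ k * v ^ (?q - k))"
    by (rule binomial_ring)
  also have "\<dots> = (\<Sum>k\<in>{0, ?q}. of_nat (?q choose k) * u ^ k * v ^ (?q - k))"
  proof (intro sum.mono_neutral_right ballI)
    fix k assume k: "k \<in> {..?q} - {0, ?q}"
    hence "of_nat (?q choose k) = (0::'a)"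
      by (intro binomial_card_finite_field) auto
    thus "of_nat (?q choose k) * u ^ k * v ^ (?q - k) = 0"
      by (simp add: of_nat_mpoly Const_0)
  qed auto
  finally show ?thesis using q by (simp add: add.commute)
qed

lemma mpoly_power_card_power_add:
  fixes u v :: "'a::{field,finite} mpoly"
  shows "(u + v) ^ (CARD('a) ^ r) = u ^ (CARD('a) ^ r) + v ^ (CARD('a) ^ r)"
  by (induction r) (simp_all only: power_0 power_one_right power_Suc2 power_mult mpoly_power_card_add)

lemma mpoly_power_card_power_sum:
  fixes f :: "'b \<Rightarrow> 'a::{field,finite} mpoly"
  shows "(\<Sum>x\<in>A. f x) ^ (CARD('a) ^ r) = (\<Sum>x\<in>A. f x ^ (CARD('a) ^ r))"
  by (induction A rule: infinite_finite_induct) (simp_all add: mpoly_power_card_power_add)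

lemma Const_power_card_power: "Const (c::'a::{field,finite}) ^ (CARD('a) ^ r) = Const c"
  by (induction r) (simp_all add: power_mult finite_field_power_card del: power_Suc add: power_Suc2 flip: Const_power)

section \<open>Polynomials over subrings and constant values\<close>

text \<open>
Subrings are plain sets here, so that polynomial coefficients can be confined to them without
leaving the type of the ambient field.
\<close>

definition is_subring :: "'r::comm_ring_1 set \<Rightarrow> bool" where
  "is_subring R \<longleftrightarrow> 1 \<in> R \<and> (\<forall>a\<in>R. \<forall>b\<in>R. a - b \<in> R \<and> a * b \<in> R)"

lemma is_subringD:
  assumes "is_subring R"
  shows "1 \<in> R" "0 \<in> R" "a \<in> R \<Longrightarrow> b \<in> R \<Longrightarrow> a - b \<in> R" "a \<in> R \<Longrightarrow> b \<in> R \<Longrightarrow> a * b \<in> R"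
    "a \<in> R \<Longrightarrow> - a \<in> R" "a \<in> R \<Longrightarrow> b \<in> R \<Longrightarrow> a + b \<in> R" "a \<in> R \<Longrightarrow> a ^ k \<in> R"
    "(\<And>x. x \<in> A \<Longrightarrow> f x \<in> R) \<Longrightarrow> sum f A \<in> R" "(\<And>x. x \<in> A \<Longrightarrow> f x \<in> R) \<Longrightarrow> prod f A \<in> R"
proof -
  have one: "1 \<in> R" and diff: "\<And>a b. a \<in> R \<Longrightarrow> b \<in> R \<Longrightarrow> a - b \<in> R"
    and mult: "\<And>a b. a \<in> R \<Longrightarrow> b \<in> R \<Longrightarrow> a * b \<in> R"
    using assms by (auto simp: is_subring_def)
  have zero: "0 \<in> R" using diff[OF one one] by simp
  have minus: "- a \<in> R" if "a \<in> R" for a using diff[OF zero that] by simp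
  have plus: "a + b \<in> R" if "a \<in> R" "b \<in> R" for a b using diff[OF that(1) minus[OF that(2)]] by simp
  show "1 \<in> R" by (rule one)
  show "0 \<in> R" by (rule zero)
  show "a - b \<in> R" if "a \<in> R" "b \<in> R" using that by (rule diff)
  show "a * b \<in> R" if "a \<in> R" "b \<in> R" using that by (rule mult)
  show "- a \<in> R" if "a \<in> R" using that by (rule minus)
  show "a + b \<in> R" if "a \<in> R" "b \<in> R" using that by (rule plus)
  show "a ^ k \<in> R" if "a \<in> R" by (induction k) (simp_all add: one mult that)
  show "sum f A \<in> R" if "\<And>x. x \<in> A \<Longrightarrow> f x \<in> R"
    using that by (induction A rule: infinite_finite_induct) (auto simp: zero plus)
  show "prod f A \<in> R" if "\<And>x. x \<in> A \<Longrightarrow> f x \<in> R"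
    using that by (induction A rule: infinite_finite_induct) (auto simp: one mult)
qed

definition polys_over :: "'r::comm_ring_1 set \<Rightarrow> 'r poly set" where
  "polys_over R = {P. \<forall>k. Polynomial.coeff P k \<in> R}"

lemma is_subring_polys_over: assumes "is_subring R" shows "is_subring (polys_over R)"
proof -
  note R = is_subringD[OF assms]
  have "(\<Sum>i\<le>k. Polynomial.coeff P i * Polynomial.coeff Q (k - i)) \<in> R"
    if "P \<in> polys_over R" "Q \<in> polys_over R" for P Q k
    using that by (intro R(8) R(4)) (auto simp: polys_over_def)
  thus ?thesis
    using R(1-3) by (auto simp: is_subring_def polys_over_def coeff_mult Polynomial.coeff_1)
qed

lemma pCons_polys_over: "is_subring R \<Longrightarrow> pCons a P \<in> polys_over R \<longleftrightarrow> a \<in> R \<and> P \<in> polys_over R"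
  by (auto simp: polys_over_def coeff_pCons all_conj_distrib split: nat.splits)

lemma smult_polys_over: "is_subring R \<Longrightarrow> a \<in> R \<Longrightarrow> P \<in> polys_over R \<Longrightarrow> smult a P \<in> polys_over R"
  by (auto simp: polys_over_def intro: is_subringD(4))

definition adjoin_elem :: "'r::comm_ring_1 set \<Rightarrow> 'r \<Rightarrow> 'r set" where
  "adjoin_elem R x = (\<lambda>P. poly P x) ` polys_over R"

lemma is_subring_adjoin_elem: assumes "is_subring R" shows "is_subring (adjoin_elem R x)"
  unfolding is_subring_def adjoin_elem_def
proof (intro conjI ballI)
  note P = is_subringD[OF is_subring_polys_over[OF assms]]
  show "1 \<in> (\<lambda>P. poly P x) ` polys_over R" by (rule image_eqI[OF _ P(1)]) simp
  fix a b assume "a \<in> (\<lambda>P. poly P x) ` polys_over R" "b \<in> (\<lambda>P. poly P x) ` polys_over R"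
  then obtain P Q where PQ: "a = poly P x" "b = poly Q x" "P \<in> polys_over R" "Q \<in> polys_over R" by auto
  show "a - b \<in> (\<lambda>P. poly P x) ` polys_over R"
    by (rule image_eqI[of _ _ "P - Q"]) (simp_all add: PQ P)
  show "a * b \<in> (\<lambda>P. poly P x) ` polys_over R"
    by (rule image_eqI[of _ _ "P * Q"]) (simp_all add: PQ P)
qed

lemma adjoin_elem_incl: assumes "is_subring R" shows "R \<subseteq> adjoin_elem R x" "x \<in> adjoin_elem R x"
proof -
  note P = is_subringD[OF assms]
  have z: "0 \<in> polys_over R" using is_subringD(2)[OF is_subring_polys_over[OF assms]] .
  show "x \<in> adjoin_elem R x" unfolding adjoin_elem_def
    by (rule image_eqI[of _ _ "[:0, 1:]"]) (use P assms z in \<open>simp_all add: pCons_polys_over\<close>)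
  show "R \<subseteq> adjoin_elem R x"
  proof
    fix a assume "a \<in> R" thus "a \<in> adjoin_elem R x" unfolding adjoin_elem_def
      by (intro image_eqI[of _ _ "[:a:]"]) (use P assms z in \<open>simp_all add: pCons_polys_over\<close>)
  qed
qed

text \<open>
The ring $R[x_0,\dots,x_{i-1}]$, built one element at a time so that an element of the next stage
is visibly a polynomial in the newest generator.
\<close>

primrec adjoin_upto :: "'r::comm_ring_1 set \<Rightarrow> (nat \<Rightarrow> 'r) \<Rightarrow> nat \<Rightarrow> 'r set" where
  "adjoin_upto R x 0 = R"
| "adjoin_upto R x (Suc i) = adjoin_elem (adjoin_upto R x i) (x i)"

lemma is_subring_adjoin_upto: "is_subring R \<Longrightarrow> is_subring (adjoin_upto R x i)"
  by (induction i) (simp_all add: is_subring_adjoin_elem)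

lemma adjoin_upto_base: "is_subring R \<Longrightarrow> R \<subseteq> adjoin_upto R x i"
proof (induction i)
  case (Suc i)
  thus ?case using adjoin_elem_incl(1)[OF is_subring_adjoin_upto[of R x i]] by auto
qed simp

lemma adjoin_upto_elem: assumes "is_subring R" "a < i" shows "x a \<in> adjoin_upto R x i"
  using assms(2)
proof (induction i)
  case (Suc i)
  have "adjoin_upto R x i \<subseteq> adjoin_upto R x (Suc i)" "x i \<in> adjoin_upto R x (Suc i)"
    by (simp_all add: adjoin_elem_incl is_subring_adjoin_upto assms)
  thus ?case using Suc by (auto simp: less_Suc_eq simp del: adjoin_upto.simps)
qed simp

lemma hom_poly_fixed_coeffs:
  assumes "\<phi> 0 = 0" "\<And>a b. \<phi> (a + b) = \<phi> a + \<phi> b" "\<And>a b. \<phi> (a * b) = \<phi> a * \<phi> b"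
    and "\<And>k. \<phi> (Polynomial.coeff P k) = Polynomial.coeff P k"
  shows "\<phi> (poly P s) = poly P (\<phi> s)"
proof -
  have "\<phi> (poly Q s) = poly (map_poly \<phi> Q) (\<phi> s)" for Q
    by (induction Q) (simp_all add: assms map_poly_pCons)
  moreover have "map_poly \<phi> P = P" by (rule poly_eqI) (simp add: coeff_map_poly assms)
  ultimately show ?thesis by simp
qed

lemma adjoin_upto_fixed:
  assumes "\<phi> 0 = 0" "\<And>a b. \<phi> (a + b) = \<phi> a + \<phi> b" "\<And>a b. \<phi> (a * b) = \<phi> a * \<phi> b"
    and "\<And>a. a \<in> R \<Longrightarrow> \<phi> a = a" "\<And>a. a < i \<Longrightarrow> \<phi> (x a) = x a" "z \<in> adjoin_upto R x i"
  shows "\<phi> z = z"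
  using assms(5,6)
proof (induction i arbitrary: z)
  case (Suc i)
  from Suc.prems obtain P where P: "P \<in> polys_over (adjoin_upto R x i)" "z = poly P (x i)"
    by (auto simp: adjoin_elem_def)
  have "\<phi> (poly P (x i)) = poly P (\<phi> (x i))"
    by (rule hom_poly_fixed_coeffs) (use P(1) Suc assms in \<open>auto simp: polys_over_def\<close>)
  thus ?case using P Suc.prems by simp
qed (use assms in auto)

text \<open>
Division with remainder by a monic polynomial does not leave the coefficient ring. Only the values
of the remainder on \<open>S\<close> matter, so Horner's scheme suffices: the coefficient that
appears in degree \<open>degree A\<close> at each step is removed by a multiple of \<open>A\<close>.
\<close>

lemma monic_division_on_roots:
  assumes R: "is_subring R" and A: "A \<in> polys_over R" "lead_coeff A = 1" "degree A > 0"
    and S: "\<And>s. s \<in> S \<Longrightarrow> poly A s = 0" and P: "P \<in> polys_over R"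
  shows "\<exists>Q\<in>polys_over R. degree Q < degree A \<and> (\<forall>s\<in>S. poly Q s = poly P s)"
  using P
proof (induction P)
  case 0
  thus ?case using A by (intro bexI[of _ 0]) auto
next
  case (pCons a P)
  note PR = is_subringD[OF is_subring_polys_over[OF R]]
  from pCons.prems have "a \<in> R" "P \<in> polys_over R" using R by (auto simp: pCons_polys_over)
  with pCons.IH obtain Q where Q: "Q \<in> polys_over R" "degree Q < degree A" "\<forall>s\<in>S. poly Q s = poly P s"
    by auto
  let ?c = "Polynomial.coeff (pCons a Q) (degree A)"
  let ?Q = "pCons a Q - smult ?c A"
  have in_R: "pCons a Q \<in> polys_over R" using R Q \<open>a \<in> R\<close> by (simp add: pCons_polys_over)
  hence "?c \<in> R" by (simp add: polys_over_def)
  hence "?Q \<in> polys_over R" using in_R A R by (intro PR smult_polys_over)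
  moreover have "degree ?Q \<le> degree A"
    using Q(2) by (intro degree_diff_le degree_smult_le) (auto simp: degree_pCons_eq_if)
  moreover have "Polynomial.coeff ?Q (degree A) = 0" using A by simp
  ultimately have "degree ?Q < degree A"
    using A(3) by (metis degree_0 leading_coeff_0_iff le_neq_implies_less)
  moreover have "\<forall>s\<in>S. poly ?Q s = poly (pCons a P) s" using Q S by simp
  ultimately show ?case using \<open>?Q \<in> polys_over R\<close> by blast
qed

text \<open>
The product $P B$ agrees on \<open>S\<close> with $z B$: both vanish where \<open>B\<close> does, and \<open>P\<close> is \<open>z\<close> elsewhere. The
remainder of $P B$ modulo \<open>A\<close> has coefficients in \<open>R\<close> and also agrees with $z B$ on \<open>S\<close>; both have
degree less than the number of points, so they are equal. As \<open>B\<close> is monic, \<open>z\<close> is a coefficient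
of that remainder. The factor \<open>B\<close> allows for roots of \<open>A\<close> at which nothing is known about \<open>P\<close>.
\<close>

lemma constant_value_in_subring:
  fixes z :: "'r::idom"
  assumes R: "is_subring R" and A: "A \<in> polys_over R" "lead_coeff A = 1"
    and S: "\<And>s. s \<in> S \<Longrightarrow> poly A s = 0" "card S = degree A"
    and B: "B \<in> polys_over R" "lead_coeff B = 1" "degree B < degree A"
    and P: "P \<in> polys_over R" "\<And>s. s \<in> S \<Longrightarrow> poly B s \<noteq> 0 \<Longrightarrow> poly P s = z"
  shows "z \<in> R"
proof -
  have PB: "P * B \<in> polys_over R"
    by (rule is_subringD(4)[OF is_subring_polys_over[OF R] P(1) B(1)])
  have "degree A > 0" using B(3) by simp
  from monic_division_on_roots[OF R A this S(1) PB]
  obtain Q where Q: "Q \<in> polys_over R" "degree Q < degree A"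
    "\<forall>s\<in>S. poly Q s = poly (P * B) s" by blast
  have "Q = smult z B"
  proof (rule poly_eqI_degree[where A = S])
    show "poly Q s = poly (smult z B) s" if "s \<in> S" for s
      using Q(3) P(2)[OF that] that by (cases "poly B s = 0") auto
    show "degree Q < card S" using Q S by simp
    show "degree (smult z B) < card S" using B S degree_smult_le[of z B] by simp
  qed
  hence "Polynomial.coeff Q (degree B) = z" using B by simp
  thus ?thesis using Q(1) by (auto simp: polys_over_def)
qed

lemma lead_coeff_prod_linear: "lead_coeff (\<Prod>v\<in>S. [:- v, 1:] :: 'r::idom poly) = 1"
  by (simp only: lead_coeff_prod lead_coeff_pCons one_neq_zero) (simp del: prod_eq_1_iff)

lemma degree_prod_linear: "degree (\<Prod>v\<in>S. [:- v, 1:] :: 'r::idom poly) = card S"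
  by (subst degree_prod_eq_sum_degree) auto

lemma poly_prod_linear_eq_0_iff:
  "finite S \<Longrightarrow> poly (\<Prod>v\<in>S. [:- v, 1:] :: 'r::idom poly) s = 0 \<longleftrightarrow> s \<in> S"
  by (auto simp: poly_prod)

lemma prod_linear_polys_over:
  fixes S :: "'r::idom set"
  assumes R: "is_subring R" "S \<subseteq> R"
  shows "(\<Prod>v\<in>S. [:- v, 1:]) \<in> polys_over R"
proof (rule is_subringD(9)[OF is_subring_polys_over[OF R(1)]])
  fix v assume "v \<in> S"
  hence "- v \<in> R" using R(2) by (intro is_subringD(5)[OF R(1)]) auto
  thus "[:- v, 1:] \<in> polys_over R"
    using is_subringD(1)[OF R(1)] is_subringD(2)[OF is_subring_polys_over[OF R(1)]]
    by (simp only: pCons_polys_over[OF R(1)] simp_thms)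
qed

section \<open>The action on polynomials and fractions\<close>

lemma subst_in_subring:
  assumes R: "is_subring R" and C: "\<And>c. Const c \<in> R" and f: "\<And>v. v \<in> var_set n m d \<Longrightarrow> f v \<in> R"
    and p: "p \<in> poly_ring n m d"
  shows "subst f p \<in> R"
  unfolding subst_def subst_monom_def
proof (intro is_subringD(4,7,8,9)[OF R] C f)
  fix t v assume "t \<in> Poly_Mapping.keys p" "v \<in> Poly_Mapping.keys t"
  thus "v \<in> var_set n m d" using p by (auto simp: poly_ring_def)
qed

lemma Const_in_poly_ring: "Const c \<in> poly_ring n m d"
  by (auto simp: poly_ring_def Const_def)

lemma Var_in_poly_ring: "v \<in> var_set n m d \<Longrightarrow> Var v \<in> poly_ring n m d"
  by (auto simp: poly_ring_def Var_def)

lemma is_subring_poly_ring: "is_subring (poly_ring n m d)"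
  unfolding is_subring_def
proof (intro conjI ballI)
  show "1 \<in> poly_ring n m d"
    using Const_in_poly_ring[of 1 n m d] by (simp add: Const_1)
  fix p r :: "'a mpoly" assume pr: "p \<in> poly_ring n m d" "r \<in> poly_ring n m d"
  have "Poly_Mapping.keys (p - r) \<subseteq> Poly_Mapping.keys p \<union> Poly_Mapping.keys r"
    by (rule keys_diff)
  thus "p - r \<in> poly_ring n m d" using pr by (fastforce simp: poly_ring_def)
  show "p * r \<in> poly_ring n m d"
    unfolding poly_ring_def
  proof (intro CollectI ballI)
    fix t assume "t \<in> Poly_Mapping.keys (p * r)"
    then obtain a b where t: "t = a + b" "a \<in> Poly_Mapping.keys p" "b \<in> Poly_Mapping.keys r"
      using keys_mult[of p r] by auto
    have "Poly_Mapping.keys t \<subseteq> Poly_Mapping.keys a \<union> Poly_Mapping.keys b"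
      unfolding t by (rule Poly_Mapping.keys_add)
    thus "Poly_Mapping.keys t \<subseteq> var_set n m d" using pr t by (auto simp: poly_ring_def)
  qed
qed

lemma act_Const: "act n \<sigma> (Const c) = Const c"
  and act_Var: "act n \<sigma> (Var v) = act_var n \<sigma> v"
  and act_0: "act n \<sigma> 0 = 0"
  and act_1: "act n \<sigma> 1 = 1"
  and act_add: "act n \<sigma> (p + r) = act n \<sigma> p + act n \<sigma> r"
  and act_mult: "act n \<sigma> (p * r) = act n \<sigma> p * act n \<sigma> r"
  and act_sum: "act n \<sigma> (sum f A) = (\<Sum>x\<in>A. act n \<sigma> (f x))"
  using subst_Const[of "act_var n \<sigma>" 1]
  by (simp_all add: act_def subst_Const subst_Var subst_0 subst_add subst_mult subst_sum Const_1)

lemma act_uminus: "act n \<sigma> (- p) = - act n \<sigma> p"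
  using act_add[of n \<sigma> p "- p"] by (simp add: act_0 minus_unique)

lemma act_diff: "act n \<sigma> (p - r) = act n \<sigma> p - act n \<sigma> r"
  using act_add[of n \<sigma> p "- r"] by (simp add: act_uminus)

lemma act_power: "act n \<sigma> (p ^ k) = act n \<sigma> p ^ k"
  by (induction k) (simp_all add: act_1 act_mult)

lemma act_prod: "act n \<sigma> (prod f A) = (\<Prod>x\<in>A. act n \<sigma> (f x))"
  by (induction A rule: infinite_finite_induct) (simp_all add: act_1 act_mult)

lemma inj_act: "\<sigma> \<in> GL n \<Longrightarrow> inj (act n \<sigma>)"
  by (rule injI) (metis act_diff act_eq_0_iff eq_iff_diff_eq_0)

lemma act_in_poly_ring:
  assumes "p \<in> poly_ring n m d"
  shows "act n \<sigma> p \<in> poly_ring n m d"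
  unfolding act_def
proof (rule subst_in_subring[OF is_subring_poly_ring Const_in_poly_ring _ assms])
  fix v assume "v \<in> var_set n m d"
  thus "act_var n \<sigma> v \<in> poly_ring n m d"
    by (auto simp: act_var_def var_set_def intro!: is_subringD(4,8)[OF is_subring_poly_ring]
        Const_in_poly_ring Var_in_poly_ring)
qed

lemma act_fract_to_fract: "\<sigma> \<in> GL n \<Longrightarrow> act_fract n \<sigma> (to_fract p) = to_fract (act n \<sigma> p)"
  by (simp add: to_fract_def act_fract_Fract act_1)

lemma fract_quotient_cases: obtains p r where "z = to_fract p / to_fract r" "r \<noteq> 0"
  by (cases z) (auto simp: Fract_conv_to_fract)

lemma act_fract_divide:
  assumes "\<sigma> \<in> GL n"
  shows "act_fract n \<sigma> (to_fract p / to_fract r) = to_fract (act n \<sigma> p) / to_fract (act n \<sigma> r)"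
proof (cases "r = 0")
  case True
  thus ?thesis using act_fract_to_fract[OF assms, of 0] by (simp add: act_0)
next
  case False
  thus ?thesis using act_fract_Fract[OF assms False, of p]
    by (simp add: Fract_conv_to_fract)
qed

lemma act_fract_add:
  assumes "\<sigma> \<in> GL n"
  shows "act_fract n \<sigma> (w + z) = act_fract n \<sigma> w + act_fract n \<sigma> z"
proof -
  obtain a b where w: "w = to_fract a / to_fract b" "b \<noteq> 0" by (rule fract_quotient_cases)
  obtain c e where z: "z = to_fract c / to_fract e" "e \<noteq> 0" by (rule fract_quotient_cases)
  have "w + z = to_fract (a * e + c * b) / to_fract (b * e)"
    using w z by (simp add: field_simps)
  thus ?thesis using w z assms
    by (simp only: act_fract_divide act_mult act_add) (simp add: field_simps act_eq_0_iff)
qed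

lemma act_fract_mult:
  assumes "\<sigma> \<in> GL n"
  shows "act_fract n \<sigma> (w * z) = act_fract n \<sigma> w * act_fract n \<sigma> z"
proof -
  obtain a b where w: "w = to_fract a / to_fract b" "b \<noteq> 0" by (rule fract_quotient_cases)
  obtain c e where z: "z = to_fract c / to_fract e" "e \<noteq> 0" by (rule fract_quotient_cases)
  have "w * z = to_fract (a * c) / to_fract (b * e)"
    using w z by (simp add: field_simps)
  thus ?thesis using w z assms
    by (simp only: act_fract_divide act_mult) (simp add: field_simps act_eq_0_iff)
qed

lemma act_fract_inverse:
  assumes "\<sigma> \<in> GL n"
  shows "act_fract n \<sigma> (inverse z) = inverse (act_fract n \<sigma> z)"
proof -
  obtain c e where z: "z = to_fract c / to_fract e" "e \<noteq> 0" by (rule fract_quotient_cases)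
  have "inverse z = to_fract e / to_fract c" using z by simp
  thus ?thesis using z assms by (simp add: act_fract_divide)
qed

lemma act_fract_Const: "\<sigma> \<in> GL n \<Longrightarrow> act_fract n \<sigma> (to_fract (Const c)) = to_fract (Const c)"
  by (simp add: act_fract_to_fract act_Const)

lemma act_fract_0: "\<sigma> \<in> GL n \<Longrightarrow> act_fract n \<sigma> 0 = 0"
  and act_fract_1: "\<sigma> \<in> GL n \<Longrightarrow> act_fract n \<sigma> 1 = 1"
  using act_fract_to_fract[of \<sigma> n 0] act_fract_to_fract[of \<sigma> n 1] by (simp_all add: act_0 act_1)

lemma act_fract_uminus: "\<sigma> \<in> GL n \<Longrightarrow> act_fract n \<sigma> (- z) = - act_fract n \<sigma> z"
  using act_fract_add[of \<sigma> n z "- z"] by (simp add: act_fract_0 minus_unique)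

lemma act_fract_diff: "\<sigma> \<in> GL n \<Longrightarrow> act_fract n \<sigma> (w - z) = act_fract n \<sigma> w - act_fract n \<sigma> z"
  using act_fract_add[of \<sigma> n w "- z"] by (simp add: act_fract_uminus)

lemma act_fract_sum:
  "\<sigma> \<in> GL n \<Longrightarrow> act_fract n \<sigma> (sum f A) = (\<Sum>x\<in>A. act_fract n \<sigma> (f x))"
  by (induction A rule: infinite_finite_induct) (simp_all add: act_fract_0 act_fract_add)

lemma act_fract_power: "\<sigma> \<in> GL n \<Longrightarrow> act_fract n \<sigma> (z ^ k) = act_fract n \<sigma> z ^ k"
  by (induction k) (simp_all add: act_fract_1 act_fract_mult)

lemma act_fract_act_fract:
  assumes "\<sigma> \<in> GL n" "\<tau> \<in> GL n" "\<sigma> * \<tau> \<in> GL n"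
  shows "act_fract n \<sigma> (act_fract n \<tau> z) = act_fract n (\<sigma> * \<tau>) z"
proof -
  obtain c e where z: "z = to_fract c / to_fract e" "e \<noteq> 0" by (rule fract_quotient_cases)
  show ?thesis using assms by (simp add: z act_fract_divide act_act)
qed

section \<open>Subfields and fields of invariants\<close>

definition is_subfield :: "'r::field set \<Rightarrow> bool" where
  "is_subfield K \<longleftrightarrow> is_subring K \<and> (\<forall>a\<in>K. inverse a \<in> K)"

lemma is_subfieldD:
  assumes "is_subfield K"
  shows "is_subring K" "a \<in> K \<Longrightarrow> inverse a \<in> K" "a \<in> K \<Longrightarrow> b \<in> K \<Longrightarrow> a / b \<in> K"
  using assms is_subringD(4)[of K a "inverse b"] by (auto simp: is_subfield_def divide_inverse)

lemma rat_field_eq: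
  "rat_field n m d = {to_fract p / to_fract r |p r. p \<in> poly_ring n m d \<and> r \<in> poly_ring n m d}"
proof -
  have "to_fract p / to_fract r \<in> rat_field n m d" if "p \<in> poly_ring n m d" "r \<in> poly_ring n m d" for p r :: "'a mpoly"
  proof (cases "r = 0")
    case True
    have "Fract 0 1 \<in> rat_field n m d"
      using is_subringD(1,2)[OF is_subring_poly_ring[of n m d]] by (force simp: rat_field_def)
    thus ?thesis using True by (simp flip: Zero_fract_def)
  next
    case False
    thus ?thesis using that by (force simp: rat_field_def Fract_conv_to_fract)
  qed
  thus ?thesis by (auto simp: rat_field_def Fract_conv_to_fract)
qed

lemma is_subfield_rat_field: "is_subfield (rat_field n m d)"
  unfolding is_subfield_def is_subring_def
proof (intro conjI ballI)
  note P = is_subringD[OF is_subring_poly_ring[of n m d]]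
  show "1 \<in> rat_field n m d"
    unfolding rat_field_eq using P(1) by (intro CollectI exI[of _ 1]) auto
  fix w :: "'a mpoly fract" assume w': "w \<in> rat_field n m d"
  then obtain a b where w: "w = to_fract a / to_fract b" "b \<noteq> 0" "a \<in> poly_ring n m d" "b \<in> poly_ring n m d"
    by (auto simp: rat_field_def Fract_conv_to_fract)
  have "inverse w = to_fract b / to_fract a" using w by simp
  thus "inverse w \<in> rat_field n m d" using w unfolding rat_field_eq by blast
  fix z :: "'a mpoly fract" assume z': "z \<in> rat_field n m d"
  then obtain c e where z: "z = to_fract c / to_fract e" "e \<noteq> 0" "c \<in> poly_ring n m d" "e \<in> poly_ring n m d"
    by (auto simp: rat_field_def Fract_conv_to_fract)
  have "w - z = to_fract (a * e - c * b) / to_fract (b * e)"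
    unfolding w(1) z(1) using w(2) z(2) by (simp add: field_simps)
  moreover have "a * e - c * b \<in> poly_ring n m d" "b * e \<in> poly_ring n m d"
    using w z by (simp_all add: P(3,4))
  ultimately show "w - z \<in> rat_field n m d" unfolding rat_field_eq by blast
  have "w * z = to_fract (a * c) / to_fract (b * e)"
    unfolding w(1) z(1) using w(2) z(2) by (simp add: field_simps)
  moreover have "a * c \<in> poly_ring n m d" "b * e \<in> poly_ring n m d"
    using w z by (simp_all add: P(4))
  ultimately show "w * z \<in> rat_field n m d" unfolding rat_field_eq by blast
qed

lemma to_fract_in_rat_field: "p \<in> poly_ring n m d \<Longrightarrow> to_fract p \<in> rat_field n m d"
  using is_subringD(1)[OF is_subring_poly_ring[of n m d]]
  by (force simp: rat_field_eq)

lemma is_subfield_invariant_field: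
  assumes "G \<subseteq> GL n"
  shows "is_subfield (invariant_field G n m d)"
  using is_subfield_rat_field[of n m d] assms
  by (auto simp: is_subfield_def is_subring_def invariant_field_def subset_iff
      act_fract_1 act_fract_diff act_fract_mult act_fract_inverse)

lemma to_fract_in_invariant_field:
  assumes "G \<subseteq> GL n" "p \<in> invariant_ring G n m d"
  shows "to_fract p \<in> invariant_field G n m d"
  using assms by (auto simp: invariant_ring_def invariant_field_def to_fract_in_rat_field
      act_fract_to_fract subset_iff)

lemma Const_in_invariant_ring: "Const c \<in> invariant_ring G n m d"
  by (simp add: invariant_ring_def Const_in_poly_ring act_Const)

lemma ring_of_type_algebra_simps:
  fixes x y :: "'r::field"
  shows "carrier (ring_of_type_algebra :: 'r ring) = UNIV"
    "\<zero>\<^bsub>ring_of_type_algebra\<^esub> = (0::'r)" "\<one>\<^bsub>ring_of_type_algebra\<^esub> = (1::'r)"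
    "x \<oplus>\<^bsub>ring_of_type_algebra\<^esub> y = x + y" "x \<otimes>\<^bsub>ring_of_type_algebra\<^esub> y = x * y"
    "\<ominus>\<^bsub>ring_of_type_algebra\<^esub> x = - x"
    "x \<noteq> 0 \<Longrightarrow> inv\<^bsub>ring_of_type_algebra\<^esub> x = inverse x"
proof -
  interpret F: field "ring_of_type_algebra :: 'r ring" by (rule field_from_type_algebra)
  show 1: "carrier (ring_of_type_algebra :: 'r ring) = UNIV"
    "\<zero>\<^bsub>ring_of_type_algebra\<^esub> = (0::'r)" "\<one>\<^bsub>ring_of_type_algebra\<^esub> = (1::'r)"
    "x \<oplus>\<^bsub>ring_of_type_algebra\<^esub> y = x + y" "x \<otimes>\<^bsub>ring_of_type_algebra\<^esub> y = x * y" for x y :: 'r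
    by (simp_all add: ring_of_type_algebra_def)
  show "\<ominus>\<^bsub>ring_of_type_algebra\<^esub> x = - x"
    by (rule F.minus_equality) (simp_all add: 1)
  show "inv\<^bsub>ring_of_type_algebra\<^esub> x = inverse x" if "x \<noteq> 0"
    by (rule F.comm_inv_char) (use that in \<open>simp_all add: 1\<close>)
qed

lemma adjoin_minimal:
  assumes K: "is_subfield K" and C: "\<And>c. to_fract (Const c) \<in> K" and S: "\<And>p. p \<in> S \<Longrightarrow> to_fract p \<in> K"
  shows "adjoin S \<subseteq> K"
proof
  note R = is_subringD[OF is_subfieldD(1)[OF K]]
  fix z assume "z \<in> adjoin S"
  thus "z \<in> K" unfolding adjoin_def to_fract_def[symmetric]
    by (induction rule: generate_field.induct)
       (use C S R is_subfieldD[OF K] in \<open>auto simp: ring_of_type_algebra_simps\<close>)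
qed

lemma is_subfield_adjoin: "is_subfield (adjoin S)"
proof -
  let ?R = "ring_of_type_algebra :: 'a mpoly fract ring"
  have one: "1 \<in> adjoin S" unfolding adjoin_def
    using generate_field.one[where R = ?R] by (simp add: ring_of_type_algebra_simps)
  have add: "a + b \<in> adjoin S" if "a \<in> adjoin S" "b \<in> adjoin S" for a b
    using that unfolding adjoin_def
    using generate_field.eng_add[where R = ?R] by (simp add: ring_of_type_algebra_simps)
  have mult: "a * b \<in> adjoin S" if "a \<in> adjoin S" "b \<in> adjoin S" for a b
    using that unfolding adjoin_def
    using generate_field.eng_mult[where R = ?R] by (simp add: ring_of_type_algebra_simps)
  have minus: "- a \<in> adjoin S" if "a \<in> adjoin S" for a
    using that unfolding adjoin_def
    using generate_field.a_inv[where R = ?R] by (simp add: ring_of_type_algebra_simps)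
  have inv: "inverse a \<in> adjoin S" if "a \<in> adjoin S" for a
  proof (cases "a = 0")
    case False
    thus ?thesis using that unfolding adjoin_def
      using generate_field.m_inv[where R = ?R] by (simp add: ring_of_type_algebra_simps)
  qed (use that in auto)
  show ?thesis unfolding is_subfield_def is_subring_def
    using one add[of _ "- _"] mult minus inv by simp
qed

lemma Const_in_adjoin: "to_fract (Const c) \<in> adjoin S"
  and in_adjoin: "p \<in> S \<Longrightarrow> to_fract p \<in> adjoin S"
  unfolding adjoin_def to_fract_def by (auto intro: generate_field.incl)

lemma finite_GL: "finite (GL n :: 'a::{field,finite} mat set)"
proof (rule finite_subset)
  let ?I = "{..<n} \<times> {..<n}"
  show "GL n \<subseteq> (\<lambda>f. mat n n f) ` (?I \<rightarrow>\<^sub>E (UNIV :: 'a set))"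
  proof
    fix A :: "'a mat" assume "A \<in> GL n"
    hence "A \<in> carrier_mat n n" by (simp add: GL_def)
    hence "A = mat n n (restrict (\<lambda>ij. A $$ ij) ?I)"
      by (intro eq_matI) simp_all
    moreover have "restrict (\<lambda>ij. A $$ ij) ?I \<in> ?I \<rightarrow>\<^sub>E UNIV"
      by (simp add: restrict_PiE_iff)
    ultimately show "A \<in> (\<lambda>f. mat n n f) ` (?I \<rightarrow>\<^sub>E UNIV)"
      by (metis imageI)
  qed
  show "finite ((\<lambda>f. mat n n f) ` (?I \<rightarrow>\<^sub>E (UNIV :: 'a set)))"
    by (intro finite_imageI finite_PiE finite_cartesian_product finite_lessThan finite)
qed

lemma GL_mult: "\<sigma> \<in> GL n \<Longrightarrow> \<tau> \<in> GL n \<Longrightarrow> \<sigma> * \<tau> \<in> (GL n :: 'a::field mat set)"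
proof -
  interpret R: ring "ring_mat TYPE('a) n ()" by (rule ring_mat)
  show "\<sigma> \<in> GL n \<Longrightarrow> \<tau> \<in> GL n \<Longrightarrow> \<sigma> * \<tau> \<in> (GL n :: 'a::field mat set)"
    using R.Units_m_closed[of \<sigma> \<tau>] by (simp add: GL_Units ring_mat_simps)
qed

lemma one_in_GL: "1\<^sub>m n \<in> (GL n :: 'a::field mat set)"
proof -
  interpret R: ring "ring_mat TYPE('a) n ()" by (rule ring_mat)
  show ?thesis using R.Units_one_closed by (simp add: GL_Units ring_mat_simps)
qed

text \<open>
An injective map of a finite set into itself permutes it; this makes products over stable sets
invariant.
\<close>

lemma act_prod_permuted:
  assumes "\<sigma> \<in> GL n" "finite S" "\<And>s. s \<in> S \<Longrightarrow> act n \<sigma> s \<in> S"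
  shows "act n \<sigma> ` S = S" "(\<Prod>s\<in>S. f (act n \<sigma> s)) = (\<Prod>s\<in>S. f s)"
proof -
  have inj: "inj_on (act n \<sigma>) S" using inj_act[OF assms(1)] by (rule inj_on_subset) simp
  show eq: "act n \<sigma> ` S = S"
    by (rule endo_inj_surj[OF assms(2) _ inj]) (use assms(3) in auto)
  show "(\<Prod>s\<in>S. f (act n \<sigma> s)) = (\<Prod>s\<in>S. f s)"
    by (subst (2) eq[symmetric]) (simp add: prod.reindex[OF inj])
qed

text \<open>
If $z = p / r$ is invariant, let \<open>N\<close> be the product of the \<open>GL\<close>-orbit of \<open>r\<close>. It is a multiple of
\<open>r\<close>, so $z N$ is a polynomial; it is invariant because \<open>z\<close> and \<open>N\<close> are, and $z = (z N) / N$.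
\<close>

lemma invariant_field_subset:
  fixes G :: "'a::{field,finite} mat set"
  assumes G: "G \<subseteq> GL n" and K: "is_subfield K"
    and inv: "\<And>p. p \<in> invariant_ring G n m d \<Longrightarrow> to_fract p \<in> K"
  shows "invariant_field G n m d \<subseteq> K"
proof
  fix z assume z: "z \<in> invariant_field G n m d"
  then obtain p r where pr: "p \<in> poly_ring n m d" "r \<in> poly_ring n m d" "r \<noteq> 0" "z = to_fract p / to_fract r"
    by (auto simp: invariant_field_def rat_field_def Fract_conv_to_fract)
  note P = is_subringD[OF is_subring_poly_ring[of n m d]]
  define S where "S = (\<lambda>\<sigma>. act n \<sigma> r) ` GL n"
  have S: "finite S" "r \<in> S" "\<And>s. s \<in> S \<Longrightarrow> s \<in> poly_ring n m d \<and> s \<noteq> 0"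
    using one_in_GL pr by (auto simp: S_def finite_GL image_iff act_one act_in_poly_ring act_eq_0_iff intro!: bexI[of _ "1\<^sub>m n"])
  define N where "N = (\<Prod>s\<in>S. s)"
  have N_inv: "act n \<sigma> N = N" if "\<sigma> \<in> G" for \<sigma>
  proof -
    have s: "\<sigma> \<in> GL n" using that G by auto
    have "act n \<sigma> s \<in> S" if "s \<in> S" for s using that s by (auto simp: S_def act_act GL_mult)
    from act_prod_permuted(2)[OF s S(1) this, where f = "\<lambda>s. s"] show ?thesis
      by (simp add: N_def act_prod)
  qed
  have N: "N \<in> poly_ring n m d" "N \<noteq> 0" unfolding N_def using S by (auto intro!: P(9))
  define p' where "p' = p * (\<Prod>s\<in>S - {r}. s)"
  have "N = r * (\<Prod>s\<in>S - {r}. s)" unfolding N_def using S by (intro prod.remove) auto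
  hence zN: "z * to_fract N = to_fract p'"
    using pr by (simp add: p'_def)
  have "p' \<in> invariant_ring G n m d" unfolding invariant_ring_def
  proof (intro CollectI conjI ballI)
    show "p' \<in> poly_ring n m d" unfolding p'_def using pr S by (intro P(4,9)) auto
    fix \<sigma> assume "\<sigma> \<in> G"
    hence s: "\<sigma> \<in> GL n" using G by auto
    have "to_fract (act n \<sigma> p') = act_fract n \<sigma> (z * to_fract N)"
      using s by (simp add: zN act_fract_to_fract)
    also have "\<dots> = z * to_fract N"
      using s z \<open>\<sigma> \<in> G\<close> by (simp add: act_fract_mult act_fract_to_fract N_inv invariant_field_def)
    also have "\<dots> = to_fract p'" by (rule zN)
    finally show "act n \<sigma> p' = p'" by simp
  qed
  hence "to_fract p' / to_fract N \<in> K"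
    using inv N N_inv K by (intro is_subfieldD(3)) (auto simp: invariant_ring_def)
  moreover have "z = to_fract p' / to_fract N" using N by (simp flip: zN)
  ultimately show "z \<in> K" by simp
qed

lemma poly_ring_mono: "m \<le> m' \<Longrightarrow> d \<le> d' \<Longrightarrow> poly_ring n m d \<subseteq> poly_ring n m' d'"
proof -
  assume "m \<le> m'" "d \<le> d'"
  hence "var_set n m d \<subseteq> var_set n m' d'" by (fastforce simp: var_set_def)
  thus ?thesis by (auto simp: poly_ring_def)
qed

section \<open>Linear forms in the first copy\<close>

definition lin_x :: "nat \<Rightarrow> (nat \<Rightarrow> 'a::field) \<Rightarrow> 'a mpoly" where
  "lin_x i c = (\<Sum>a<i. Const (c a) * Var (xv 0 a))"

definition span_x :: "nat \<Rightarrow> 'a::field mpoly set" where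
  "span_x i = range (lin_x i)"

text \<open>
The variables are linearly independent: the coefficients of a linear form can be read off.
\<close>

lemma lookup_lin_x:
  "Poly_Mapping.lookup (lin_x i c) (Poly_Mapping.single (xv 0 a) 1) = (if a < i then c a else 0)"
proof -
  have 1: "Const u * Var v = Poly_Mapping.single (Poly_Mapping.single v 1) u" for u :: 'a and v
    by (simp add: Const_def Var_def mult_single)
  have 2: "Poly_Mapping.single (xv 0 b) (1::nat) = Poly_Mapping.single (xv 0 a) 1 \<longleftrightarrow> b = a" for b
  proof
    assume "Poly_Mapping.single (xv 0 b) (1::nat) = Poly_Mapping.single (xv 0 a) 1"
    hence "Poly_Mapping.lookup (Poly_Mapping.single (xv 0 b) (1::nat)) (xv 0 a) = 1" by simp
    thus "b = a" by (auto simp: lookup_single when_def split: if_splits)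
  qed simp
  have "Poly_Mapping.lookup (lin_x i c) (Poly_Mapping.single (xv 0 a) 1) = (\<Sum>b<i. if b = a then c b else 0)"
    unfolding lin_x_def lookup_sum 1 lookup_single when_def 2 ..
  thus ?thesis by simp
qed

lemma lin_x_eq_iff: "lin_x i c = lin_x i c' \<longleftrightarrow> (\<forall>a<i. c a = c' a)"
proof
  assume "lin_x i c = lin_x i c'"
  thus "\<forall>a<i. c a = c' a" using lookup_lin_x[of i c] lookup_lin_x[of i c'] by metis
qed (simp add: lin_x_def)

lemma span_x_eq: "span_x i = lin_x i ` ({..<i} \<rightarrow>\<^sub>E UNIV)"
proof -
  have "lin_x i c = lin_x i (restrict c {..<i})" for c :: "nat \<Rightarrow> 'a" by (simp add: lin_x_eq_iff)
  moreover have "restrict c {..<i} \<in> {..<i} \<rightarrow>\<^sub>E UNIV" for c :: "nat \<Rightarrow> 'a" by (simp add: restrict_PiE_iff)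
  ultimately have "lin_x i c \<in> lin_x i ` ({..<i} \<rightarrow>\<^sub>E UNIV)" for c :: "nat \<Rightarrow> 'a"
    by (metis imageI)
  thus ?thesis by (auto simp: span_x_def)
qed

lemma finite_span_x: "finite (span_x i :: 'a::{field,finite} mpoly set)"
  unfolding span_x_eq by (intro finite_imageI finite_PiE finite_lessThan finite)

lemma card_span_x: "card (span_x i :: 'a::{field,finite} mpoly set) = CARD('a) ^ i"
proof -
  have "inj_on (lin_x i) ({..<i} \<rightarrow>\<^sub>E (UNIV :: 'a set))"
    by (intro inj_onI PiE_ext) (auto simp: lin_x_eq_iff)
  thus ?thesis unfolding span_x_eq by (simp add: card_image card_PiE)
qed

lemma lin_x_unit: "a < i \<Longrightarrow> lin_x i (\<lambda>b. if b = a then 1 else 0) = Var (xv 0 a)"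
  by (simp add: lin_x_def if_distrib[of Const] if_distrib[of "\<lambda>c. c * _"] Const_0 Const_1 cong: if_cong)

lemma Var_in_span_x: "a < i \<Longrightarrow> Var (xv 0 a) \<in> span_x i"
  unfolding span_x_def by (metis lin_x_unit rangeI)

lemma lin_x_truncate: "i \<le> n \<Longrightarrow> lin_x i c = lin_x n (\<lambda>a. if a < i then c a else 0)"
proof -
  assume "i \<le> n"
  hence "lin_x n (\<lambda>a. if a < i then c a else 0) = (\<Sum>a\<in>{..<i}. Const (if a < i then c a else 0) * Var (xv 0 a))"
    unfolding lin_x_def by (intro sum.mono_neutral_right) (auto simp: Const_0)
  thus ?thesis by (simp add: lin_x_def)
qed

lemma lin_x_in_span_iff:
  assumes "i \<le> n"
  shows "lin_x n c \<in> span_x i \<longleftrightarrow> (\<forall>a<n. i \<le> a \<longrightarrow> c a = 0)"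
proof
  assume "lin_x n c \<in> span_x i"
  then obtain c' where "lin_x n c = lin_x i c'" by (auto simp: span_x_def)
  hence "lin_x n c = lin_x n (\<lambda>a. if a < i then c' a else 0)"
    using lin_x_truncate[OF assms, of c'] by simp
  thus "\<forall>a<n. i \<le> a \<longrightarrow> c a = 0" by (auto simp: lin_x_eq_iff)
next
  assume "\<forall>a<n. i \<le> a \<longrightarrow> c a = 0"
  hence "lin_x n c = lin_x i c" by (auto simp: lin_x_truncate[OF assms] lin_x_eq_iff)
  thus "lin_x n c \<in> span_x i" by (simp add: span_x_def)
qed

lemma span_x_poly_ring: "span_x i \<subseteq> poly_ring i 1 0"
  by (auto simp: span_x_def lin_x_def var_set_def intro!: is_subringD(4,8)[OF is_subring_poly_ring]
      Const_in_poly_ring Var_in_poly_ring)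

lemma span_x_add: "u \<in> span_x i \<Longrightarrow> v \<in> span_x i \<Longrightarrow> u + v \<in> span_x i"
proof -
  have "lin_x i c + lin_x i c' = lin_x i (\<lambda>a. c a + c' a)" for c c' :: "nat \<Rightarrow> 'a"
    by (simp add: lin_x_def Const_add distrib_right sum.distrib)
  thus "u \<in> span_x i \<Longrightarrow> v \<in> span_x i \<Longrightarrow> u + v \<in> span_x i" by (auto simp: span_x_def)
qed

lemma act_lin_x:
  assumes "i \<le> n"
  shows "act n \<sigma> (lin_x i c) = lin_x n (\<lambda>b. \<Sum>a<i. \<sigma> $$ (b, a) * c a)"
proof -
  have "act n \<sigma> (lin_x i c) = (\<Sum>a<i. Const (c a) * (\<Sum>b<n. Const (\<sigma> $$ (b, a)) * Var (xv 0 b)))"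
    using assms by (auto simp: lin_x_def act_sum act_mult act_Const act_Var act_var_def intro!: sum.cong)
  also have "\<dots> = (\<Sum>b<n. \<Sum>a<i. Const (\<sigma> $$ (b, a) * c a) * Var (xv 0 b))"
    unfolding sum_distrib_left by (subst sum.swap) (simp add: Const_mult mult_ac)
  finally show ?thesis by (simp add: lin_x_def Const_sum sum_distrib_right)
qed

lemma act_span_x: "v \<in> span_x n \<Longrightarrow> act n \<sigma> v \<in> span_x n"
  by (auto simp: span_x_def act_lin_x)

abbreviation mat_inverse :: "nat \<Rightarrow> 'a::field mat \<Rightarrow> 'a mat" where
  "mat_inverse n \<sigma> \<equiv> inv\<^bsub>ring_mat TYPE('a) n ()\<^esub> \<sigma>"

lemma GL_inverse_entries:
  fixes \<sigma> :: "'a::field mat"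
  assumes "\<sigma> \<in> GL n" "a < n" "b < n"
  shows "(\<Sum>i<n. \<sigma> $$ (a, i) * mat_inverse n \<sigma> $$ (i, b)) = (if a = b then 1 else 0)"
proof -
  interpret R: ring "ring_mat TYPE('a) n ()" by (rule ring_mat)
  have U: "\<sigma> \<in> Units (ring_mat TYPE('a) n ())" using assms by (simp add: GL_Units)
  have car: "\<sigma> \<in> carrier_mat n n" "mat_inverse n \<sigma> \<in> carrier_mat n n"
    using R.Units_closed[OF U] R.Units_inv_closed[OF U] by (simp_all add: ring_mat_simps)
  have "\<sigma> * mat_inverse n \<sigma> = 1\<^sub>m n" using R.Units_r_inv[OF U] by (simp add: ring_mat_simps)
  moreover have "(\<sigma> * mat_inverse n \<sigma>) $$ (a, b) = (\<Sum>i<n. \<sigma> $$ (a, i) * mat_inverse n \<sigma> $$ (i, b))"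
    using car assms by (auto simp: scalar_prod_def atLeast0LessThan intro!: sum.cong)
  ultimately show ?thesis using assms by simp
qed

section \<open>The Moore matrix\<close>

text \<open>
The $q$-polynomial $\sum_{r<n} w_r T^{q^r}$. It is $F_q$-linear as a function, hence vanishes on a
whole span once it vanishes on a basis.
\<close>

definition additive_poly :: "nat \<Rightarrow> (nat \<Rightarrow> 'a::{field,finite} mpoly) \<Rightarrow> 'a mpoly poly" where
  "additive_poly n w = (\<Sum>r<n. Polynomial.monom (w r) (CARD('a) ^ r))"

lemma card_power_eq_iff: "CARD('a::{field,finite}) ^ r = CARD('a) ^ s \<longleftrightarrow> r = s"
  using card_field_ge_2[where 'a='a] by (intro power_inject_exp) simp

lemma coeff_additive_poly:
  fixes w :: "nat \<Rightarrow> 'a::{field,finite} mpoly"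
  shows "Polynomial.coeff (additive_poly n w) (CARD('a) ^ r) = (if r < n then w r else 0)"
    "(\<And>r. r < n \<Longrightarrow> k \<noteq> CARD('a) ^ r) \<Longrightarrow> Polynomial.coeff (additive_poly n w) k = 0"
proof -
  show "Polynomial.coeff (additive_poly n w) (CARD('a) ^ r) = (if r < n then w r else 0)"
    unfolding additive_poly_def Polynomial.coeff_sum coeff_monom card_power_eq_iff by simp
  show "Polynomial.coeff (additive_poly n w) k = 0" if "\<And>r. r < n \<Longrightarrow> k \<noteq> CARD('a) ^ r"
    unfolding additive_poly_def Polynomial.coeff_sum coeff_monom
    by (intro sum.neutral ballI) (use that in auto)
qed

lemma degree_additive_poly:
  fixes w :: "nat \<Rightarrow> 'a::{field,finite} mpoly"
  shows "degree (additive_poly (Suc n) w) \<le> CARD('a) ^ n"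
  unfolding additive_poly_def
proof (rule degree_sum_le)
  fix r assume "r \<in> {..<Suc n}"
  thus "degree (Polynomial.monom (w r) (CARD('a) ^ r)) \<le> CARD('a) ^ n"
    using card_field_ge_2[where 'a='a]
    by (intro order.trans[OF degree_monom_le] power_increasing) auto
qed simp

lemma poly_additive_poly:
  fixes w :: "nat \<Rightarrow> 'a::{field,finite} mpoly"
  shows "poly (additive_poly n w) x = (\<Sum>r<n. w r * x ^ (CARD('a) ^ r))"
  by (simp add: additive_poly_def poly_sum poly_monom)

lemma poly_additive_poly_lin_x:
  "poly (additive_poly n w) (lin_x i c) = (\<Sum>a<i. Const (c a) * poly (additive_poly n w) (Var (xv 0 a)))"
  unfolding poly_additive_poly lin_x_def
  by (simp add: mpoly_power_card_power_sum power_mult_distrib Const_power_card_power sum_distrib_left)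
     (subst sum.swap, simp add: mult_ac)

lemma additive_poly_roots:
  assumes "\<And>a. a < n \<Longrightarrow> poly (additive_poly k w) (Var (xv 0 a)) = 0" "v \<in> span_x n"
  shows "poly (additive_poly k w) v = 0"
  using assms by (auto simp: span_x_def poly_additive_poly_lin_x)

text \<open>
A relation between the rows of the Moore matrix is a $q$-polynomial of degree at most $q^{n-1}$ that
vanishes at each variable, and therefore at the $q^n$ elements of their span.
\<close>

lemma moore_independent:
  fixes w :: "nat \<Rightarrow> 'a::{field,finite} mpoly"
  assumes "\<And>a. a < n \<Longrightarrow> (\<Sum>r<n. w r * Var (xv 0 a) ^ (CARD('a) ^ r)) = 0" "r < n"
  shows "w r = 0"
proof -
  obtain k where n: "n = Suc k" using assms(2) by (cases n) auto
  have lt: "CARD('a) ^ k < CARD('a) ^ n"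
    using card_field_ge_2[where 'a='a] unfolding n by (intro power_strict_increasing) auto
  have "additive_poly n w = 0"
  proof (rule poly_eqI_degree[where A = "span_x n"])
    show "poly (additive_poly n w) v = poly 0 v" if "v \<in> span_x n" for v
      using additive_poly_roots[of n n w v] assms that by (simp add: poly_additive_poly)
    show "degree (additive_poly n w) < card (span_x n :: 'a mpoly set)"
      using le_less_trans[OF degree_additive_poly lt, of w] by (simp only: card_span_x n)
  qed (use lt in \<open>simp add: card_span_x\<close>)
  thus ?thesis using coeff_additive_poly(1)[of n w r] assms(2) by simp
qed

definition moore :: "nat \<Rightarrow> 'a::{field,finite} mpoly mat" where
  "moore n = mat n n (\<lambda>(r, i). Var (xv 0 i) ^ (CARD('a) ^ r))"

lemma moore_carrier: "moore n \<in> carrier_mat n n"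
  by (simp add: moore_def)

definition moore_det :: "nat \<Rightarrow> 'a::{field,finite} mpoly" where
  "moore_det n = det (moore n)"

lemma moore_det_nonzero: "moore_det n \<noteq> 0"
proof
  let ?M = "transpose_mat (moore n) :: 'a mpoly mat"
  assume "moore_det n = (0 :: 'a mpoly)"
  hence "det ?M = 0" by (simp add: moore_det_def det_transpose[OF moore_carrier])
  then obtain v where v: "v \<in> carrier_vec n" "v \<noteq> 0\<^sub>v n" "?M *\<^sub>v v = 0\<^sub>v n"
    using det_0_iff_vec_prod_zero[of ?M n] moore_carrier[of n, where 'a='a] by auto
  have "(\<Sum>r<n. v $ r * Var (xv 0 a) ^ (CARD('a) ^ r)) = 0" if "a < n" for a
  proof -
    have "(?M *\<^sub>v v) $ a = (\<Sum>r<n. v $ r * Var (xv 0 a) ^ (CARD('a) ^ r))"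
      using that v(1) by (auto simp: moore_def scalar_prod_def atLeast0LessThan mult.commute intro!: sum.cong)
    thus ?thesis using v(3) that by simp
  qed
  from moore_independent[of n "\<lambda>r. v $ r", OF this] have "v = 0\<^sub>v n"
    using v(1) by (intro eq_vecI) auto
  with v show False by simp
qed

text \<open>
The adjugate of the Moore matrix, which carries its inverse without denominators.
\<close>

definition moore_adj :: "nat \<Rightarrow> nat \<Rightarrow> nat \<Rightarrow> 'a::{field,finite} mpoly" where
  "moore_adj n b r = adj_mat (moore n) $$ (b, r)"

lemma moore_adj_inverse:
  assumes "a < n" "b < n"
  shows "(\<Sum>r<n. moore_adj n b r * Var (xv 0 a) ^ (CARD('a::{field,finite}) ^ r)) =
    (if a = b then moore_det n else (0 :: 'a mpoly))"
proof -
  let ?M = "moore n :: 'a mpoly mat"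
  note A = adj_mat[OF moore_carrier[of n, where 'a='a]]
  have "(adj_mat ?M * ?M) $$ (b, a) = (\<Sum>r<n. moore_adj n b r * Var (xv 0 a) ^ (CARD('a) ^ r))"
    using assms A(1) by (auto simp: scalar_prod_def atLeast0LessThan moore_def moore_adj_def intro!: sum.cong)
  thus ?thesis using A(3) assms by (auto simp: moore_det_def)
qed

lemma det_in_subring:
  assumes "is_subring R" "A \<in> carrier_mat n n" "\<And>i j. i < n \<Longrightarrow> j < n \<Longrightarrow> A $$ (i, j) \<in> R"
  shows "det A \<in> R"
  unfolding det_def'[OF assms(2)]
proof (intro is_subringD(4,8,9)[OF assms(1)])
  fix p i assume "p \<in> {p. p permutes {0..<n}}" "i \<in> {0..<n}"
  thus "A $$ (i, p i) \<in> R" using permutes_in_image[of p "{0..<n}" i] by (intro assms(3)) auto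
next
  fix p show "signof p \<in> R"
    using is_subringD(1,5)[OF assms(1)] by (auto simp: sign_def)
qed

lemma moore_entry_in_poly_ring: "i < n \<Longrightarrow> r < n \<Longrightarrow> moore n $$ (r, i) \<in> poly_ring n 1 0"
  by (auto simp: moore_def var_set_def intro!: is_subringD(7)[OF is_subring_poly_ring] Var_in_poly_ring)

lemma moore_det_in_poly_ring: "moore_det n \<in> poly_ring n 1 0"
  unfolding moore_det_def
  by (rule det_in_subring[OF is_subring_poly_ring moore_carrier moore_entry_in_poly_ring])

lemma moore_adj_in_poly_ring:
  assumes "b < n" "r < n"
  shows "(moore_adj n b r :: 'a::{field,finite} mpoly) \<in> poly_ring n 1 0"
proof -
  let ?M = "moore n :: 'a mpoly mat"
  note P = is_subringD[OF is_subring_poly_ring[of n 1 0, where 'a='a]]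
  have "moore_adj n b r = cofactor ?M r b"
    using assms by (simp add: moore_adj_def adj_mat_def moore_def)
  moreover have "det (mat_delete ?M r b) \<in> poly_ring n 1 0"
  proof (rule det_in_subring[OF is_subring_poly_ring mat_delete_carrier[OF moore_carrier]])
    fix i j assume "i < n - 1" "j < n - 1"
    thus "mat_delete ?M r b $$ (i, j) \<in> poly_ring n 1 0"
      using moore_carrier[of n, where 'a='a]
      by (auto simp: mat_delete_def intro!: moore_entry_in_poly_ring[unfolded One_nat_def])
  qed
  ultimately show ?thesis unfolding cofactor_def by (simp only: P(4)[OF P(7)[OF P(5)[OF P(1)]]])
qed

lemma comm_ring_hom_act: "comm_ring_hom (act n \<sigma>)"
  by unfold_locales (simp_all add: act_0 act_1 act_add act_mult)

lemma comm_ring_hom_Const: "comm_ring_hom (Const :: 'a::field \<Rightarrow> _)"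
  by unfold_locales (simp_all add: Const_0 Const_1 Const_add Const_mult)

lemma act_Var_power:
  assumes "i < n"
  shows "act n \<sigma> (Var (xv j i) ^ (CARD('a::{field,finite}) ^ r)) =
    (\<Sum>a<n. Const (\<sigma> $$ (a, i) :: 'a) * Var (xv j a) ^ (CARD('a) ^ r))"
  using assms by (simp add: act_power act_Var act_var_def mpoly_power_card_power_sum
      power_mult_distrib Const_power_card_power)

text \<open>
Taking $q^r$-th powers fixes the entries of \<open>\<sigma>\<close>, so each row of the Moore matrix transforms like the
row of variables and the whole matrix is multiplied by \<open>\<sigma>\<close> from the right.
\<close>

lemma act_moore_det:
  fixes \<sigma> :: "'a::{field,finite} mat"
  assumes "\<sigma> \<in> carrier_mat n n"
  shows "act n \<sigma> (moore_det n) = Const (det \<sigma>) * moore_det n"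
proof -
  let ?M = "moore n :: 'a mpoly mat"
  interpret A: comm_ring_hom "act n \<sigma>" by (rule comm_ring_hom_act)
  interpret C: comm_ring_hom "Const :: 'a \<Rightarrow> 'a mpoly" by (rule comm_ring_hom_Const)
  have "map_mat (act n \<sigma>) ?M = ?M * map_mat Const \<sigma>"
  proof (rule eq_matI)
    fix r i assume "r < dim_row (?M * map_mat Const \<sigma>)" "i < dim_col (?M * map_mat Const \<sigma>)"
    hence "r < n" "i < n" using assms by (auto simp: moore_def)
    thus "map_mat (act n \<sigma>) ?M $$ (r, i) = (?M * map_mat Const \<sigma>) $$ (r, i)"
      using assms by (auto simp: moore_def act_Var_power scalar_prod_def atLeast0LessThan mult.commute intro!: sum.cong)
  qed (use assms in \<open>auto simp: moore_def\<close>)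
  hence "act n \<sigma> (det ?M) = det (?M * map_mat Const \<sigma>)" by (metis A.hom_det)
  also have "\<dots> = det ?M * Const (det \<sigma>)"
    using assms by (subst det_mult[OF moore_carrier]) auto
  finally show ?thesis by (simp add: moore_det_def mult.commute)
qed

section \<open>Dickson invariants\<close>

definition dickson_poly :: "nat \<Rightarrow> 'a::{field,finite} mpoly poly" where
  "dickson_poly n = (\<Prod>v\<in>span_x n. [:- v, 1:])"

text \<open>
For \<open>r < n\<close> these are the Dickson invariants, up to sign the classical generators of the
invariants of \<open>GL\<close> in one copy of \<open>W\<close>.
\<close>

definition dickson :: "nat \<Rightarrow> nat \<Rightarrow> 'a::{field,finite} mpoly" where
  "dickson n r = Polynomial.coeff (dickson_poly n) (CARD('a) ^ r)"

text \<open>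
Solving a linear system with the Moore matrix produces a $q$-polynomial of degree $q^n$ with leading
coefficient \<open>D\<close> that vanishes at every variable, hence on their span. The product over the
span, multiplied by \<open>D\<close>, has the same degree, leading coefficient and roots.
\<close>

lemma dickson_poly_eq:
  "dickson_poly n = additive_poly (Suc n) (\<lambda>r. if r = n then 1 else dickson n r :: 'a::{field,finite} mpoly)"
proof -
  let ?q = "CARD('a)" and ?P = "dickson_poly n :: 'a mpoly poly"
  define w :: "nat \<Rightarrow> 'a mpoly" where
    "w r = (if r = n then moore_det n else - (\<Sum>b<n. Var (xv 0 b) ^ (?q ^ n) * moore_adj n b r))" for r
  have deg: "degree ?P = ?q ^ n" by (simp add: dickson_poly_def degree_prod_linear card_span_x)
  have lead: "Polynomial.coeff ?P (?q ^ n) = 1"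
    using lead_coeff_prod_linear[of "span_x n :: 'a mpoly set"] deg by (simp add: dickson_poly_def)
  have root: "poly (additive_poly (Suc n) w) (Var (xv 0 a)) = 0" if "a < n" for a
  proof -
    have "(\<Sum>r<n. (\<Sum>b<n. Var (xv 0 b) ^ (?q ^ n) * moore_adj n b r) * Var (xv 0 a) ^ (?q ^ r))
        = (\<Sum>b<n. Var (xv 0 b) ^ (?q ^ n) * (\<Sum>r<n. moore_adj n b r * Var (xv 0 a) ^ (?q ^ r)))"
      unfolding sum_distrib_left sum_distrib_right by (subst sum.swap) (simp add: mult.assoc)
    also have "\<dots> = (\<Sum>b<n. if a = b then Var (xv 0 b) ^ (?q ^ n) * (moore_det n :: 'a mpoly) else 0)"
      by (intro sum.cong refl) (simp add: moore_adj_inverse that)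
    also have "\<dots> = Var (xv 0 a) ^ (?q ^ n) * moore_det n" using that by simp
    finally have "(\<Sum>r<n. w r * Var (xv 0 a) ^ (?q ^ r)) = - (moore_det n * Var (xv 0 a) ^ (?q ^ n))"
      by (simp add: w_def sum_negf mult.commute)
    thus ?thesis by (simp add: poly_additive_poly w_def)
  qed
  have "smult (moore_det n) ?P = additive_poly (Suc n) w"
  proof (rule poly_eqI_degree_lead_coeff[where A = "span_x n" and n = "?q ^ n"])
    show "Polynomial.coeff (smult (moore_det n) ?P) (?q ^ n) = Polynomial.coeff (additive_poly (Suc n) w) (?q ^ n)"
      using lead by (simp add: coeff_additive_poly(1)) (simp add: w_def)
    show "poly (smult (moore_det n) ?P) v = poly (additive_poly (Suc n) w) v" if "v \<in> span_x n" for v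
      using additive_poly_roots[OF root that] that
      by (simp add: dickson_poly_def poly_prod_linear_eq_0_iff[OF finite_span_x])
    show "degree (smult (moore_det n) ?P) \<le> ?q ^ n" using degree_smult_le[of "moore_det n" ?P] deg by simp
  qed (simp_all add: card_span_x degree_additive_poly)
  hence zero: "Polynomial.coeff ?P k = 0" if "\<And>r. r < Suc n \<Longrightarrow> k \<noteq> ?q ^ r" for k
    using coeff_additive_poly(2)[where n = "Suc n" and w = w and k = k, OF that] moore_det_nonzero[of n, where 'a='a]
    by (metis coeff_smult mult_eq_0_iff)
  show ?thesis
  proof (rule poly_eqI)
    fix k show "Polynomial.coeff ?P k =
      Polynomial.coeff (additive_poly (Suc n) (\<lambda>r. if r = n then 1 else dickson n r)) k"
    proof (cases "\<exists>r<Suc n. k = ?q ^ r")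
      case True
      then obtain r where "r < Suc n" "k = ?q ^ r" by blast
      thus ?thesis using lead by (simp add: coeff_additive_poly(1) dickson_def)
    next
      case False
      thus ?thesis by (subst zero, blast, subst coeff_additive_poly(2)) auto
    qed
  qed
qed

lemma dickson_relation:
  assumes "a < n"
  shows "Var (xv 0 a) ^ (CARD('a::{field,finite}) ^ n) =
    - (\<Sum>r<n. dickson n r * Var (xv 0 a) ^ (CARD('a) ^ r) :: 'a mpoly)"
proof -
  have "poly (dickson_poly n) (Var (xv 0 a) :: 'a mpoly) = 0"
    unfolding dickson_poly_def using assms by (simp add: poly_prod_linear_eq_0_iff finite_span_x Var_in_span_x)
  thus ?thesis unfolding dickson_poly_eq poly_additive_poly
    by (simp add: eq_neg_iff_add_eq_0 add.commute)
qed

lemma act_dickson: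
  fixes \<sigma> :: "'a::{field,finite} mat"
  assumes "\<sigma> \<in> GL n"
  shows "act n \<sigma> (dickson n r) = dickson n r"
proof -
  interpret A: comm_ring_hom "act n \<sigma>" by (rule comm_ring_hom_act)
  interpret P: map_poly_comm_ring_hom "act n \<sigma>" ..
  have "map_poly (act n \<sigma>) (dickson_poly n) = (\<Prod>v\<in>span_x n. [:- act n \<sigma> v, 1:])"
    by (simp add: dickson_poly_def P.hom_prod act_uminus act_1 act_0 map_poly_pCons)
  also have "\<dots> = dickson_poly n" unfolding dickson_poly_def
    by (rule act_prod_permuted(2)[OF assms finite_span_x act_span_x])
  finally have "Polynomial.coeff (map_poly (act n \<sigma>) (dickson_poly n)) k = Polynomial.coeff (dickson_poly n) k" for k
    by simp
  thus ?thesis by (simp add: dickson_def coeff_map_poly act_0)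
qed

lemma dickson_in_poly_ring: "dickson n r \<in> poly_ring n 1 0"
  using prod_linear_polys_over[OF is_subring_poly_ring span_x_poly_ring, of n]
  by (auto simp: dickson_def dickson_poly_def polys_over_def)

text \<open>
By \<open>dickson_relation\<close> the Moore matrix with all entries raised to the power \<open>q\<close> is the product of a
companion matrix and the Moore matrix. Taking determinants gives $D^q = \det(C)\, D$, and
$\det(C)$ is the Dickson invariant of index 0 up to sign.
\<close>

lemma dickson_0:
  assumes "n \<ge> 1"
  shows "(dickson n 0 :: 'a::{field,finite} mpoly) = (- 1) ^ n * moore_det n ^ (CARD('a) - 1)"
proof -
  let ?q = "CARD('a)" and ?M = "moore n :: 'a mpoly mat"
  have q: "?q \<ge> 2" by (rule card_field_ge_2)
  interpret F: comm_ring_hom "\<lambda>p :: 'a mpoly. p ^ ?q"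
    using q by unfold_locales (simp_all add: mpoly_power_card_add power_mult_distrib)
  define C :: "'a mpoly mat" where
    "C = mat n n (\<lambda>(r, s). if Suc r = n then - dickson n s else if s = Suc r then 1 else 0)"
  have C: "C \<in> carrier_mat n n" by (simp add: C_def)
  have "map_mat (\<lambda>p. p ^ ?q) ?M = C * ?M"
  proof (rule eq_matI)
    fix r i assume "r < dim_row (C * ?M)" "i < dim_col (C * ?M)"
    hence ri: "r < n" "i < n" by (auto simp: moore_def C_def)
    have "(C * ?M) $$ (r, i) = (\<Sum>s<n. C $$ (r, s) * Var (xv 0 i) ^ (?q ^ s))"
      using ri C by (auto simp: moore_def scalar_prod_def atLeast0LessThan intro!: sum.cong)
    also have "\<dots> = Var (xv 0 i) ^ (?q ^ Suc r)"
    proof (cases "Suc r = n")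
      case True
      thus ?thesis using ri by (simp add: C_def dickson_relation sum_negf)
    next
      case False
      hence "Suc r < n" using ri by simp
      have "(\<Sum>s<n. C $$ (r, s) * Var (xv 0 i) ^ (?q ^ s)) =
          (\<Sum>s<n. if s = Suc r then Var (xv 0 i) ^ (?q ^ s) else 0)"
        using ri False by (intro sum.cong refl) (simp add: C_def)
      thus ?thesis using \<open>Suc r < n\<close> by simp
    qed
    also have "\<dots> = map_mat (\<lambda>p. p ^ ?q) ?M $$ (r, i)"
      using ri by (simp add: moore_def mult.commute flip: power_mult)
    finally show "map_mat (\<lambda>p. p ^ ?q) ?M $$ (r, i) = (C * ?M) $$ (r, i)" ..
  qed (auto simp: moore_def C_def)
  hence "moore_det n ^ ?q = det C * moore_det n"
    using F.hom_det[of ?M] det_mult[OF C moore_carrier] by (simp add: moore_det_def)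
  moreover have "moore_det n ^ ?q = moore_det n ^ (?q - 1) * (moore_det n :: 'a mpoly)"
    using q by (metis Suc_diff_1 card_field_ge_2 dual_order.strict_trans1 pos2 power_Suc2)
  ultimately have 1: "det C = moore_det n ^ (?q - 1)" using moore_det_nonzero[of n, where 'a='a] by simp
  have "det C = (\<Sum>i<n. C $$ (i, 0) * cofactor C i 0)"
    using assms by (intro laplace_expansion_column[OF C]) simp
  also have "\<dots> = (\<Sum>i\<in>{n - 1}. C $$ (i, 0) * cofactor C i 0)"
    using assms by (intro sum.mono_neutral_right) (auto simp: C_def)
  also have "\<dots> = - dickson n 0 * cofactor C (n - 1) 0" using assms by (simp add: C_def)
  also have "cofactor C (n - 1) 0 = (- 1) ^ (n - 1)"
  proof -
    have "mat_delete C (n - 1) 0 = 1\<^sub>m (n - 1)"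
      by (rule eq_matI) (auto simp: mat_delete_def C_def)
    thus ?thesis by (simp add: cofactor_def)
  qed
  finally have "moore_det n ^ (?q - 1) = (- 1) ^ n * (dickson n 0 :: 'a mpoly)"
    using 1 assms by (cases n) (simp_all add: mult.commute)
  hence "(- 1) ^ n * moore_det n ^ (?q - 1) = (- 1) ^ n * ((- 1) ^ n * (dickson n 0 :: 'a mpoly))" by (rule arg_cong)
  also have "\<dots> = dickson n 0" by (simp flip: mult.assoc power_add)
  finally show ?thesis ..
qed

section \<open>Invariants that are linear in the other copies\<close>

text \<open>
Up to the factor $D^{q-1}$ these are the coordinates of the row $x_j$ in the basis formed by the rows
of the Moore matrix (see \<open>moore_coordinate_relation\<close>). The factor clears the denominator and is
itself invariant under \<open>GL\<close>.
\<close>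

definition moore_coordinate :: "nat \<Rightarrow> nat \<Rightarrow> nat \<Rightarrow> 'a::{field,finite} mpoly" where
  "moore_coordinate n j r = moore_det n ^ (CARD('a) - 2) * (\<Sum>b<n. Var (xv j b) * moore_adj n b r)"

text \<open>
The pairing of the $q^r$-th power of the first vector with the \<open>k\<close>-th covector.
\<close>

definition twisted_pairing :: "nat \<Rightarrow> nat \<Rightarrow> nat \<Rightarrow> 'a::{field,finite} mpoly" where
  "twisted_pairing n k r = (\<Sum>i<n. Var (xv 0 i) ^ (CARD('a) ^ r) * Var (yv k i))"

lemma moore_det_powers:
  "moore_det n ^ (CARD('a) - 2) * moore_det n = (moore_det n ^ (CARD('a) - 1) :: 'a::{field,finite} mpoly)"
proof -
  have "CARD('a) - 1 = Suc (CARD('a) - 2)" using card_field_ge_2[where 'a='a] by simp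
  thus ?thesis by simp
qed

lemma moore_coordinate_relation:
  assumes "a < n"
  shows "(\<Sum>r<n. moore_coordinate n j r * Var (xv 0 a) ^ (CARD('a::{field,finite}) ^ r)) =
    moore_det n ^ (CARD('a) - 1) * (Var (xv j a) :: 'a mpoly)"
proof -
  let ?q = "CARD('a)"
  have "(\<Sum>r<n. moore_coordinate n j r * Var (xv 0 a) ^ (?q ^ r)) =
      moore_det n ^ (?q - 2) * (\<Sum>b<n. Var (xv j b) * (\<Sum>r<n. moore_adj n b r * Var (xv 0 a) ^ (?q ^ r) :: 'a mpoly))"
    unfolding moore_coordinate_def sum_distrib_left sum_distrib_right by (subst sum.swap) (simp add: mult.assoc)
  also have "(\<Sum>b<n. Var (xv j b) * (\<Sum>r<n. moore_adj n b r * Var (xv 0 a) ^ (?q ^ r) :: 'a mpoly)) =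
      (\<Sum>b<n. if a = b then Var (xv j b) * moore_det n else 0)"
    by (intro sum.cong refl) (simp add: moore_adj_inverse assms)
  also have "\<dots> = Var (xv j a) * moore_det n" using assms by simp
  finally show ?thesis using moore_det_powers[of n, where 'a='a] by (simp add: mult_ac)
qed

lemma twisted_pairing_relation:
  assumes "b < n"
  shows "(\<Sum>r<n. moore_adj n b r * twisted_pairing n k r) = moore_det n * (Var (yv k b) :: 'a::{field,finite} mpoly)"
proof -
  let ?q = "CARD('a)"
  have "(\<Sum>r<n. moore_adj n b r * twisted_pairing n k r) =
      (\<Sum>i<n. (\<Sum>r<n. moore_adj n b r * Var (xv 0 i) ^ (?q ^ r)) * (Var (yv k i) :: 'a mpoly))"
    unfolding twisted_pairing_def sum_distrib_left sum_distrib_right by (subst sum.swap) (simp add: mult.assoc)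
  also have "\<dots> = (\<Sum>i<n. if i = b then moore_det n * Var (yv k i) else 0)"
    by (intro sum.cong refl) (simp add: moore_adj_inverse assms)
  finally show ?thesis using assms by simp
qed

text \<open>
The \<open>q\<close>-power twist of the vector is transformed by the same matrix as the vector itself, and the
covector by the inverse matrix.
\<close>

lemma act_twisted_pairing:
  fixes \<sigma> :: "'a::{field,finite} mat"
  assumes "\<sigma> \<in> GL n"
  shows "act n \<sigma> (twisted_pairing n k r) = twisted_pairing n k r"
proof -
  let ?q = "CARD('a)" and ?\<tau> = "mat_inverse n \<sigma>"
  have "act n \<sigma> (twisted_pairing n k r) =
      (\<Sum>i<n. (\<Sum>a<n. Const (\<sigma> $$ (a, i)) * Var (xv 0 a) ^ (?q ^ r)) * (\<Sum>b<n. Const (?\<tau> $$ (i, b)) * Var (yv k b)))"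
    by (simp add: twisted_pairing_def act_sum act_mult act_Var_power) (simp add: act_Var act_var_def)
  also have "\<dots> = (\<Sum>i<n. \<Sum>a<n. \<Sum>b<n. Const (\<sigma> $$ (a, i) * ?\<tau> $$ (i, b)) * (Var (xv 0 a) ^ (?q ^ r) * Var (yv k b)))"
    unfolding sum_product by (simp add: Const_mult mult_ac)
  also have "\<dots> = (\<Sum>a<n. \<Sum>i<n. \<Sum>b<n. Const (\<sigma> $$ (a, i) * ?\<tau> $$ (i, b)) * (Var (xv 0 a) ^ (?q ^ r) * Var (yv k b)))"
    by (rule sum.swap)
  also have "\<dots> = (\<Sum>a<n. \<Sum>b<n. \<Sum>i<n. Const (\<sigma> $$ (a, i) * ?\<tau> $$ (i, b)) * (Var (xv 0 a) ^ (?q ^ r) * Var (yv k b)))"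
    by (intro sum.cong refl sum.swap)
  also have "\<dots> = (\<Sum>a<n. \<Sum>b<n. Const (if a = b then 1 else 0) * (Var (xv 0 a) ^ (?q ^ r) * Var (yv k b)))"
    by (intro sum.cong refl) (simp add: GL_inverse_entries[OF assms, symmetric] Const_sum sum_distrib_right)
  also have "\<dots> = (\<Sum>a<n. \<Sum>b<n. if a = b then Var (xv 0 a) ^ (?q ^ r) * Var (yv k b) else 0)"
    by (intro sum.cong refl) (simp add: Const_0 Const_1)
  also have "\<dots> = twisted_pairing n k r" by (simp add: twisted_pairing_def)
  finally show ?thesis .
qed

lemma act_moore_det_power:
  fixes \<sigma> :: "'a::{field,finite} mat"
  assumes "\<sigma> \<in> GL n"
  shows "act n \<sigma> (moore_det n ^ (CARD('a) - 1)) = moore_det n ^ (CARD('a) - 1)"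
proof -
  have car: "\<sigma> \<in> carrier_mat n n" using assms by (simp add: GL_def)
  have "det \<sigma> \<noteq> 0"
    using act_moore_det[OF car] act_eq_0_iff[OF assms, of "moore_det n"] moore_det_nonzero[of n, where 'a='a]
    by (auto simp: Const_0)
  hence "det \<sigma> ^ (CARD('a) - 1) = 1" by (rule finite_field_power_card_minus_1)
  thus ?thesis
    by (simp add: act_power act_moore_det[OF car] power_mult_distrib Const_1 del: One_nat_def flip: Const_power)
qed

text \<open>
Applying \<open>\<sigma>\<close> to \<open>moore_coordinate_relation\<close> and cancelling \<open>\<sigma>\<close> shows that the transformed
coordinates satisfy the same linear system, whose solution is unique by \<open>moore_independent\<close>.
\<close>

lemma act_moore_coordinate:
  fixes \<sigma> :: "'a::{field,finite} mat"
  assumes "\<sigma> \<in> GL n" "r < n"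
  shows "act n \<sigma> (moore_coordinate n j r) = moore_coordinate n j r"
proof -
  let ?q = "CARD('a)" and ?\<tau> = "mat_inverse n \<sigma>" and ?D = "moore_det n ^ (CARD('a) - 1) :: 'a mpoly"
  define e where "e a = (\<Sum>r<n. act n \<sigma> (moore_coordinate n j r) * Var (xv 0 a) ^ (?q ^ r)) - ?D * Var (xv j a)" for a
  have e: "(\<Sum>a<n. Const (\<sigma> $$ (a, i)) * e a) = 0" if "i < n" for i
  proof -
    have "act n \<sigma> (\<Sum>r<n. moore_coordinate n j r * Var (xv 0 i) ^ (?q ^ r)) = act n \<sigma> (?D * Var (xv j i))"
      by (simp add: moore_coordinate_relation that)
    hence "(\<Sum>r<n. act n \<sigma> (moore_coordinate n j r) * (\<Sum>a<n. Const (\<sigma> $$ (a, i)) * Var (xv 0 a) ^ (?q ^ r))) =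
        ?D * (\<Sum>a<n. Const (\<sigma> $$ (a, i)) * Var (xv j a))"
      using that by (simp add: act_sum act_mult act_Var_power act_moore_det_power[OF assms(1)] del: One_nat_def)
        (simp add: act_Var act_var_def)
    also have "(\<Sum>r<n. act n \<sigma> (moore_coordinate n j r) * (\<Sum>a<n. Const (\<sigma> $$ (a, i)) * Var (xv 0 a) ^ (?q ^ r))) =
        (\<Sum>a<n. Const (\<sigma> $$ (a, i)) * (\<Sum>r<n. act n \<sigma> (moore_coordinate n j r) * Var (xv 0 a) ^ (?q ^ r)))"
      unfolding sum_distrib_left by (subst sum.swap) (simp add: mult_ac)
    finally show ?thesis
      by (simp add: e_def right_diff_distrib sum_subtractf sum_distrib_left mult_ac)
  qed
  have "e b = 0" if "b < n" for b
  proof -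
    have "0 = (\<Sum>i<n. Const (?\<tau> $$ (i, b)) * (\<Sum>a<n. Const (\<sigma> $$ (a, i)) * e a))" by (simp add: e)
    also have "\<dots> = (\<Sum>a<n. \<Sum>i<n. Const (\<sigma> $$ (a, i) * ?\<tau> $$ (i, b)) * e a)"
      unfolding sum_distrib_left by (subst sum.swap) (simp add: Const_mult mult_ac)
    also have "\<dots> = (\<Sum>a<n. Const (if a = b then 1 else 0) * e a)"
      using that by (intro sum.cong refl)
        (simp add: GL_inverse_entries[OF assms(1), symmetric] Const_sum sum_distrib_right)
    also have "\<dots> = (\<Sum>a<n. if a = b then e a else 0)"
      by (intro sum.cong refl) (simp add: Const_0 Const_1)
    finally show ?thesis using that by simp
  qed
  hence "(\<Sum>r<n. (act n \<sigma> (moore_coordinate n j r) - moore_coordinate n j r) * Var (xv 0 a) ^ (?q ^ r)) = 0" if "a < n" for a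
    using that moore_coordinate_relation[OF that, of j, where 'a='a] by (simp add: e_def left_diff_distrib sum_subtractf)
  from moore_independent[OF this assms(2)] show ?thesis by simp
qed

lemma twisted_pairing_in_poly_ring: "k < d \<Longrightarrow> m \<ge> 1 \<Longrightarrow> twisted_pairing n k r \<in> poly_ring n m d"
  unfolding twisted_pairing_def
  by (intro is_subringD(4,7,8)[OF is_subring_poly_ring] Var_in_poly_ring) (auto simp: var_set_def)

lemma moore_coordinate_in_poly_ring: "j < m \<Longrightarrow> r < n \<Longrightarrow> moore_coordinate n j r \<in> poly_ring n m d"
  unfolding moore_coordinate_def
  using poly_ring_mono[of 1 m 0 d n, where 'a='a] moore_det_in_poly_ring[of n, where 'a='a]
    moore_adj_in_poly_ring[of _ n r, where 'a='a]
  by (intro is_subringD(4,7,8)[OF is_subring_poly_ring] Var_in_poly_ring) (auto simp: var_set_def)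

section \<open>Descent to the ground field\<close>

definition tower :: "'a::field mpoly fract set \<Rightarrow> nat \<Rightarrow> 'a mpoly fract set" where
  "tower K = adjoin_upto K (\<lambda>a. to_fract (Var (xv 0 a)))"

lemma is_subring_tower: "is_subring K \<Longrightarrow> is_subring (tower K i)"
  by (simp add: tower_def is_subring_adjoin_upto)

lemma tower_base: "is_subring K \<Longrightarrow> K \<subseteq> tower K i"
  by (simp add: tower_def adjoin_upto_base)

lemma Var_in_tower: "is_subring K \<Longrightarrow> a < i \<Longrightarrow> to_fract (Var (xv 0 a)) \<in> tower K i"
  using adjoin_upto_elem[of K a i "\<lambda>a. to_fract (Var (xv 0 a))"] by (simp add: tower_def)

lemma to_fract_sum: "to_fract (sum f A) = (\<Sum>x\<in>A. to_fract (f x))"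
  by (induction A rule: infinite_finite_induct) simp_all

lemma to_fract_prod: "to_fract (prod f A) = (\<Prod>x\<in>A. to_fract (f x))"
  by (induction A rule: infinite_finite_induct) simp_all

lemma to_fract_power: "to_fract (p ^ k) = to_fract p ^ k"
  by (induction k) simp_all

lemma to_fract_vimage_subring: "is_subring R \<Longrightarrow> is_subring {p. to_fract p \<in> R}"
  by (auto simp: is_subring_def)

lemma poly_ring_subset_vimage:
  assumes R: "is_subring R" and C: "\<And>c. to_fract (Const c) \<in> R"
    and V: "\<And>v. v \<in> var_set n m d \<Longrightarrow> to_fract (Var v) \<in> R" and p: "p \<in> poly_ring n m d"
  shows "to_fract p \<in> R"
  using subst_in_subring[OF to_fract_vimage_subring[OF R] _ _ p, of Var] C V
  by (simp add: subst_Var_id)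

lemma poly_ring_subset_tower:
  assumes K: "is_subring K" and C: "\<And>c. to_fract (Const c) \<in> K" and p: "p \<in> poly_ring i 1 0"
  shows "to_fract p \<in> tower K i"
proof (rule poly_ring_subset_vimage[OF is_subring_tower[OF K] _ _ p])
  show "to_fract (Const c) \<in> tower K i" for c using C tower_base[OF K] by blast
  show "to_fract (Var v) \<in> tower K i" if "v \<in> var_set i 1 0" for v
    using that Var_in_tower[OF K] by (auto simp: var_set_def)
qed

text \<open>
One step of the descent: an invariant $P(x_i)$ with \<open>P\<close> over the \<open>i\<close>-th ring has the value
\<open>z\<close> at each image \<open>s\<close> of $x_i$ under an element of \<open>G\<close> that fixes the earlier variables, and
\<open>constant_value_in_subring\<close> applies.
\<close>

lemma tower_descent:
  fixes K :: "'a::{field,finite} mpoly fract set"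
  assumes G: "G \<subseteq> GL n" and K: "is_subring K"
    and fixed: "\<And>a \<sigma>. a \<in> K \<Longrightarrow> \<sigma> \<in> G \<Longrightarrow> act_fract n \<sigma> a = a"
    and A: "\<And>i. i < n \<Longrightarrow> A i \<in> polys_over (tower K i)" "\<And>i. i < n \<Longrightarrow> lead_coeff (A i) = 1"
    and B: "\<And>i. i < n \<Longrightarrow> B i \<in> polys_over (tower K i)" "\<And>i. i < n \<Longrightarrow> lead_coeff (B i) = 1"
      "\<And>i. i < n \<Longrightarrow> degree (B i) < degree (A i)"
    and S: "\<And>i. i < n \<Longrightarrow> card (S i) = degree (A i)" "\<And>i s. i < n \<Longrightarrow> s \<in> S i \<Longrightarrow> poly (A i) s = 0"
    and move: "\<And>i s. i < n \<Longrightarrow> s \<in> S i \<Longrightarrow> poly (B i) s \<noteq> 0 \<Longrightarrow>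
      \<exists>\<sigma>\<in>G. (\<forall>a<i. act n \<sigma> (Var (xv 0 a)) = Var (xv 0 a)) \<and> to_fract (act n \<sigma> (Var (xv 0 i))) = s"
    and z: "z \<in> tower K n" "\<And>\<sigma>. \<sigma> \<in> G \<Longrightarrow> act_fract n \<sigma> z = z"
  shows "z \<in> K"
proof -
  have "i \<le> n \<Longrightarrow> z \<in> tower K i \<Longrightarrow> z \<in> K" for i
  proof (induction i)
    case 0
    thus ?case by (simp add: tower_def)
  next
    case (Suc i)
    hence i: "i < n" by simp
    from Suc.prems(2) obtain P where P: "P \<in> polys_over (tower K i)" "z = poly P (to_fract (Var (xv 0 i)))"
      by (auto simp: tower_def adjoin_elem_def)
    have "z \<in> tower K i"
    proof (rule constant_value_in_subring[OF is_subring_tower[OF K] A[OF i] S(2,1)[OF i] B[OF i] P(1)])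
      fix s assume s: "s \<in> S i" "poly (B i) s \<noteq> 0"
      obtain \<sigma> where \<sigma>: "\<sigma> \<in> G" "\<forall>a<i. act n \<sigma> (Var (xv 0 a)) = Var (xv 0 a)"
        "to_fract (act n \<sigma> (Var (xv 0 i))) = s" using move[OF i s] by blast
      have GL: "\<sigma> \<in> GL n" using \<sigma> G by auto
      have "act_fract n \<sigma> c = c" if "c \<in> tower K i" for c
        using that unfolding tower_def
        by (rule adjoin_upto_fixed[rotated -1])
          (use \<sigma> GL fixed in \<open>auto simp: act_fract_0 act_fract_add act_fract_mult act_fract_to_fract\<close>)
      hence "act_fract n \<sigma> z = poly P s"
        unfolding P(2) using P(1) \<sigma>(3) GL
        by (subst hom_poly_fixed_coeffs)
          (auto simp: act_fract_0 act_fract_add act_fract_mult act_fract_to_fract polys_over_def)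
      thus "poly P s = z" using z(2) \<sigma>(1) by simp
    qed
    thus ?case using Suc by simp
  qed
  thus ?thesis using z(1) by blast
qed

lemma act_Var_lin_x: "a < n \<Longrightarrow> act n \<sigma> (Var (xv 0 a)) = lin_x n (\<lambda>b. \<sigma> $$ (b, a))"
  by (simp add: act_Var act_var_def lin_x_def)

section \<open>The general linear group\<close>

text \<open>
Every vector outside the span of the first \<open>i\<close> basis vectors can follow them in a basis. Explicitly,
if the coordinate \<open>b \<ge> i\<close> of \<open>c\<close> is not zero, exchange the columns \<open>i\<close> and \<open>b\<close> of the identity matrix
and then put \<open>c\<close> in place of column \<open>i\<close>.
\<close>

lemma GL_move:
  fixes c :: "nat \<Rightarrow> 'a::field"
  assumes "i \<le> b" "b < n" "c b \<noteq> 0"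
  shows "\<exists>\<sigma>\<in>GL n. (\<forall>a<i. act n \<sigma> (Var (xv 0 a)) = Var (xv 0 a)) \<and> act n \<sigma> (Var (xv 0 i)) = lin_x n c"
proof -
  define \<sigma> where "\<sigma> = mat n n (\<lambda>(r, s). if s = i then c r else if s = b then (if r = i then 1 else 0)
    else if r = s then 1 else 0)"
  have car: "\<sigma> \<in> carrier_mat n n" by (simp add: \<sigma>_def)
  have "det \<sigma> \<noteq> 0"
  proof
    assume "det \<sigma> = 0"
    then obtain w where w: "w \<in> carrier_vec n" "w \<noteq> 0\<^sub>v n" "\<sigma> *\<^sub>v w = 0\<^sub>v n"
      using det_0_iff_vec_prod_zero_field[OF car] by auto
    have row: "(\<Sum>s<n. \<sigma> $$ (r, s) * w $ s) = 0" if "r < n" for r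
    proof -
      have "(\<sigma> *\<^sub>v w) $ r = (\<Sum>s<n. \<sigma> $$ (r, s) * w $ s)"
        using that w(1) car by (auto simp: scalar_prod_def atLeast0LessThan intro!: sum.cong)
      thus ?thesis using w(3) that by simp
    qed
    have "(\<Sum>s<n. \<sigma> $$ (b, s) * w $ s) = (\<Sum>s\<in>{i}. \<sigma> $$ (b, s) * w $ s)"
      using assms by (intro sum.mono_neutral_right) (auto simp: \<sigma>_def)
    hence wi: "w $ i = 0" using row[of b] assms by (simp add: \<sigma>_def)
    have "w $ t = 0" if "t < n" for t
    proof (cases "t = i")
      case False
      \<comment> \<open>in this row only the entry in column \<open>t\<close> can contribute once \<open>w $ i = 0\<close>\<close>
      define r where "r = (if t = b then i else t)"
      have "(\<Sum>s<n. \<sigma> $$ (r, s) * w $ s) = (\<Sum>s\<in>{t}. \<sigma> $$ (r, s) * w $ s)"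
        using assms that wi False by (intro sum.mono_neutral_right) (auto simp: \<sigma>_def r_def)
      thus ?thesis using row[of r] assms that False by (auto simp: \<sigma>_def r_def split: if_splits)
    qed (simp add: wi)
    hence "w = 0\<^sub>v n" using w(1) by (intro eq_vecI) auto
    with w show False by simp
  qed
  hence "\<sigma> \<in> GL n" using det_non_zero_imp_unit[OF car] by (simp add: GL_Units)
  moreover have "act n \<sigma> (Var (xv 0 a)) = Var (xv 0 a)" if "a < i" for a
  proof -
    have a: "a < n" using that assms by simp
    have "act n \<sigma> (Var (xv 0 a)) = lin_x n (\<lambda>b. if b = a then 1 else 0)"
      unfolding act_Var_lin_x[OF a] lin_x_eq_iff using that assms by (auto simp: \<sigma>_def)
    thus ?thesis using a by (simp add: lin_x_unit)
  qed
  moreover have "act n \<sigma> (Var (xv 0 i)) = lin_x n c"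
    using assms by (subst act_Var_lin_x) (auto simp: lin_x_eq_iff \<sigma>_def)
  ultimately show ?thesis by blast
qed

lemma span_x_subset_tower:
  assumes "is_subring K" "\<And>c. to_fract (Const c) \<in> K"
  shows "to_fract ` span_x i \<subseteq> tower K i"
  using poly_ring_subset_tower[OF assms] span_x_poly_ring by blast

lemma card_to_fract_image: "card (to_fract ` S) = card S"
  by (rule card_image) (auto simp: inj_on_def)

lemma GL_descent:
  fixes K :: "'a::{field,finite} mpoly fract set"
  assumes K: "is_subring K" and C: "\<And>c. to_fract (Const c) \<in> K"
    and fixed: "\<And>a \<sigma>. a \<in> K \<Longrightarrow> \<sigma> \<in> GL n \<Longrightarrow> act_fract n \<sigma> a = a"
    and f: "\<And>r. r < n \<Longrightarrow> to_fract (dickson n r) \<in> K"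
    and z: "z \<in> tower K n" "\<And>\<sigma>. \<sigma> \<in> GL n \<Longrightarrow> act_fract n \<sigma> z = z"
  shows "z \<in> K"
proof -
  let ?lin = "\<lambda>k. \<Prod>v\<in>to_fract ` (span_x k :: 'a mpoly set). [:- v, 1:]"
  let ?P = "dickson_poly n :: 'a mpoly poly"
  have "Polynomial.coeff ?P k = 0 \<or> Polynomial.coeff ?P k = 1 \<or>
      (\<exists>r<n. Polynomial.coeff ?P k = dickson n r)" for k
  proof (cases "\<exists>r<Suc n. k = CARD('a) ^ r")
    case True
    then obtain r where r: "r < Suc n" "k = CARD('a) ^ r" by blast
    hence "Polynomial.coeff ?P k = (if r = n then 1 else dickson n r)"
      unfolding dickson_poly_eq by (simp add: coeff_additive_poly(1))
    moreover have "r < n" if "r \<noteq> n" using r(1) that by simp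
    ultimately show ?thesis by (auto split: if_splits)
  next
    case False
    thus ?thesis unfolding dickson_poly_eq by (subst coeff_additive_poly(2)) auto
  qed
  hence "to_fract (Polynomial.coeff ?P k) \<in> K" for k
    using f is_subringD(1,2)[OF K] by (metis to_fract_0 to_fract_1)
  moreover have "map_poly to_fract ?P = ?lin n"
  proof -
    interpret H: comm_ring_hom "to_fract :: 'a mpoly \<Rightarrow> _" by unfold_locales simp_all
    interpret P: map_poly_comm_ring_hom "to_fract :: 'a mpoly \<Rightarrow> _" ..
    show ?thesis
      by (simp add: dickson_poly_def P.hom_prod map_poly_pCons prod.reindex inj_on_def)
  qed
  ultimately have A: "?lin n \<in> polys_over (tower K i)" for i
    using tower_base[OF K, of i] by (auto simp: polys_over_def coeff_map_poly simp flip: \<open>_ = ?lin n\<close>)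
  show ?thesis
  \<comment> \<open>A polynomial that represents \<open>z\<close> is known to have the value \<open>z\<close> only at the roots of \<open>?lin n\<close>
    that \<open>GL n\<close> can reach; the factor \<open>?lin i\<close> vanishes at the others, the elements of \<open>span_x i\<close>.\<close>
  proof (rule tower_descent[where A = "\<lambda>_. ?lin n" and B = ?lin and S = "\<lambda>_. to_fract ` span_x n",
        OF subset_refl K fixed A lead_coeff_prod_linear _ lead_coeff_prod_linear _ _ _ _ z])
    fix i assume i: "i < n"
    show "?lin i \<in> polys_over (tower K i)"
      by (rule prod_linear_polys_over[OF is_subring_tower[OF K] span_x_subset_tower[OF K C]])
    have "CARD('a) ^ i < CARD('a) ^ n"
      using i card_field_ge_2[where 'a='a] by (intro power_strict_increasing) auto
    thus "degree (?lin i) < degree (?lin n)"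
      unfolding degree_prod_linear card_to_fract_image card_span_x .
    show "card (to_fract ` (span_x n :: 'a mpoly set)) = degree (?lin n)"
      unfolding degree_prod_linear ..
    fix s assume s: "s \<in> to_fract ` (span_x n :: 'a mpoly set)"
    show "poly (?lin n) s = 0" using s by (subst poly_prod_linear_eq_0_iff) (auto simp: finite_span_x)
    assume "poly (?lin i) s \<noteq> 0"
    hence "s \<notin> to_fract ` span_x i"
      by (subst (asm) poly_prod_linear_eq_0_iff) (auto simp: finite_span_x)
    with s obtain c where c: "s = to_fract (lin_x n c)" "lin_x n c \<notin> span_x i"
      by (auto simp: span_x_def)
    then obtain b where "i \<le> b" "b < n" "c b \<noteq> 0" using lin_x_in_span_iff[of i n c] i by auto
    from GL_move[of i b n c, OF this] c(1)
    show "\<exists>\<sigma>\<in>GL n. (\<forall>a<i. act n \<sigma> (Var (xv 0 a)) = Var (xv 0 a)) \<and>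
        to_fract (act n \<sigma> (Var (xv 0 i))) = s" by auto
  qed
qed

section \<open>The unitriangular group\<close>

text \<open>
The orbit of $x_i$ under the unitriangular group is the coset $x_i + V_i$.
\<close>

definition orbit_norm :: "nat \<Rightarrow> 'a::{field,finite} mpoly" where
  "orbit_norm i = (\<Prod>s\<in>(\<lambda>v. Var (xv 0 i) + v) ` span_x i. s)"

lemma Const_uminus: "Const (- c) = - Const c"
  using Const_add[of "- c" c] by (simp add: Const_0 eq_neg_iff_add_eq_0)

lemma span_x_uminus: "v \<in> span_x i \<Longrightarrow> - v \<in> span_x i"
proof -
  have "- lin_x i c = lin_x i (\<lambda>a. - c a)" for c :: "nat \<Rightarrow> 'a"
    by (simp add: lin_x_def Const_uminus sum_negf)
  thus "v \<in> span_x i \<Longrightarrow> - v \<in> span_x i" by (auto simp: span_x_def)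
qed

text \<open>
This form shows that every element of the coset is a root of $\prod_{v \in V_i}(T - v) - N_i$.
\<close>

lemma orbit_norm_eq:
  fixes u :: "'a::{field,finite} mpoly"
  assumes "u \<in> span_x i"
  shows "orbit_norm i = (\<Prod>v\<in>span_x i. Var (xv 0 i) + u - v)"
proof -
  note m = span_x_uminus
  show ?thesis unfolding orbit_norm_def
  proof (rule prod.reindex_bij_witness[where i = "\<lambda>v. Var (xv 0 i) + u - v" and j = "\<lambda>s. Var (xv 0 i) + u - s"])
    fix v :: "'a mpoly" assume "v \<in> span_x i"
    hence "u + - v \<in> span_x i" using assms m by (intro span_x_add)
    thus "Var (xv 0 i) + u - v \<in> (\<lambda>v. Var (xv 0 i) + v) ` span_x i"
      by (intro image_eqI[of _ _ "u + - v"]) simp_all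
  next
    fix s :: "'a mpoly" assume "s \<in> (\<lambda>v. Var (xv 0 i) + v) ` span_x i"
    then obtain v where v: "v \<in> span_x i" "s = Var (xv 0 i) + v" by auto
    hence "u + - v \<in> span_x i" using assms m by (intro span_x_add)
    thus "Var (xv 0 i) + u - s \<in> span_x i" using v by simp
  qed auto
qed

lemma UT_act_coset:
  assumes "\<sigma> \<in> UT n" "i < n"
  shows "\<exists>u\<in>span_x i. act n \<sigma> (Var (xv 0 i)) = Var (xv 0 i) + u"
    "v \<in> span_x i \<Longrightarrow> act n \<sigma> v \<in> span_x i"
proof -
  have car: "\<sigma> \<in> carrier_mat n n" and low: "\<And>r s. s < r \<Longrightarrow> r < n \<Longrightarrow> \<sigma> $$ (r, s) = 0"
    and diag: "\<And>r. r < n \<Longrightarrow> \<sigma> $$ (r, r) = 1"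
    using assms(1) by (auto simp: UT_def upper_triangular_def)
  have "act n \<sigma> (Var (xv 0 i)) = (\<Sum>b<n. Const (\<sigma> $$ (b, i)) * Var (xv 0 b))"
    using assms(2) by (simp add: act_Var_lin_x lin_x_def)
  also have "\<dots> = (\<Sum>b<Suc i. Const (\<sigma> $$ (b, i)) * Var (xv 0 b))"
    using assms(2) low by (intro sum.mono_neutral_right) (auto simp: Const_0)
  also have "\<dots> = Var (xv 0 i) + lin_x i (\<lambda>b. \<sigma> $$ (b, i))"
    using assms(2) diag by (simp add: lin_x_def Const_1 add.commute)
  finally show "\<exists>u\<in>span_x i. act n \<sigma> (Var (xv 0 i)) = Var (xv 0 i) + u"
    by (auto simp: span_x_def)
  show "act n \<sigma> v \<in> span_x i" if v: "v \<in> span_x i"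
  proof -
    obtain c where c: "v = lin_x i c" using v by (auto simp: span_x_def)
    have "i \<le> n" using assms(2) by simp
    have "lin_x n (\<lambda>b. \<Sum>a<i. \<sigma> $$ (b, a) * c a) \<in> span_x i"
      unfolding lin_x_in_span_iff[OF \<open>i \<le> n\<close>] using low by (auto intro!: sum.neutral)
    thus ?thesis unfolding c act_lin_x[OF \<open>i \<le> n\<close>] .
  qed
qed

lemma UT_subset_GL: "UT n \<subseteq> GL n"
  using UT_subset_SL SL_subset_GL by blast

lemma act_orbit_norm:
  fixes \<sigma> :: "'a::{field,finite} mat"
  assumes "\<sigma> \<in> UT n" "i < n"
  shows "act n \<sigma> (orbit_norm i) = orbit_norm i"
proof -
  let ?S = "(\<lambda>v. Var (xv 0 i) + v) ` (span_x i :: 'a mpoly set)"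
  have "\<sigma> \<in> GL n" using assms UT_subset_GL by auto
  moreover have "act n \<sigma> s \<in> ?S" if "s \<in> ?S" for s
  proof -
    from \<open>s \<in> ?S\<close> obtain v where v: "v \<in> span_x i" "s = Var (xv 0 i) + v" by blast
    obtain u where u: "u \<in> span_x i" "act n \<sigma> (Var (xv 0 i)) = Var (xv 0 i) + u"
      using UT_act_coset(1)[OF assms] by auto
    have "act n \<sigma> s = Var (xv 0 i) + (u + act n \<sigma> v)" by (simp add: v act_add u add.assoc)
    thus ?thesis using span_x_add[OF u(1) UT_act_coset(2)[OF assms v(1)]] by blast
  qed
  ultimately show ?thesis
    unfolding orbit_norm_def act_prod using act_prod_permuted(2)[of \<sigma> n ?S "\<lambda>s. s"] by (simp add: finite_span_x)
qed

lemma orbit_norm_in_poly_ring: "i < n \<Longrightarrow> orbit_norm i \<in> poly_ring n 1 0"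
proof -
  assume "i < n"
  have "span_x i \<subseteq> (poly_ring n 1 0 :: 'a mpoly set)"
  proof -
    have "var_set i 1 0 \<subseteq> var_set n 1 0" using \<open>i < n\<close> by (auto simp: var_set_def)
    hence "(poly_ring i 1 0 :: 'a mpoly set) \<subseteq> poly_ring n 1 0" by (auto simp: poly_ring_def)
    thus ?thesis using span_x_poly_ring by blast
  qed
  moreover have "Var (xv 0 i) \<in> (poly_ring n 1 0 :: 'a mpoly set)"
    using \<open>i < n\<close> by (intro Var_in_poly_ring) (auto simp: var_set_def)
  ultimately show ?thesis unfolding orbit_norm_def
    by (intro is_subringD(9)[OF is_subring_poly_ring]) (auto intro!: is_subringD(6)[OF is_subring_poly_ring])
qed

lemma UT_move:
  fixes c :: "nat \<Rightarrow> 'a::field"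
  assumes "i < n"
  shows "\<exists>\<sigma>\<in>UT n. (\<forall>a<i. act n \<sigma> (Var (xv 0 a)) = Var (xv 0 a)) \<and>
    act n \<sigma> (Var (xv 0 i)) = Var (xv 0 i) + lin_x i c"
proof -
  define \<sigma> where "\<sigma> = mat n n (\<lambda>(r, s). if r = s then 1 else if s = i \<and> r < i then c r else 0)"
  have "\<sigma> \<in> UT n" by (auto simp: UT_def \<sigma>_def upper_triangular_def)
  moreover have "act n \<sigma> (Var (xv 0 a)) = Var (xv 0 a)" if "a < i" for a
  proof -
    have a: "a < n" using that assms by simp
    have "act n \<sigma> (Var (xv 0 a)) = lin_x n (\<lambda>b. if b = a then 1 else 0)"
      unfolding act_Var_lin_x[OF a] lin_x_eq_iff using that assms by (auto simp: \<sigma>_def)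
    thus ?thesis using a by (simp add: lin_x_unit)
  qed
  moreover have "act n \<sigma> (Var (xv 0 i)) = Var (xv 0 i) + lin_x i c"
  proof -
    have "lin_x n (\<lambda>b. \<sigma> $$ (b, i)) = lin_x n (\<lambda>b. (if b = i then 1 else 0) + (if b < i then c b else 0))"
      unfolding lin_x_eq_iff using assms by (auto simp: \<sigma>_def)
    also have "\<dots> = lin_x n (\<lambda>b. if b = i then 1 else 0) + lin_x n (\<lambda>b. if b < i then c b else 0)"
      by (simp add: lin_x_def Const_add distrib_right sum.distrib)
    finally show ?thesis
      using assms by (simp add: act_Var_lin_x lin_x_unit lin_x_truncate[of i n])
  qed
  ultimately show ?thesis by blast
qed

lemma UT_descent:
  fixes K :: "'a::{field,finite} mpoly fract set"
  assumes K: "is_subring K" and C: "\<And>c. to_fract (Const c) \<in> K"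
    and fixed: "\<And>a \<sigma>. a \<in> K \<Longrightarrow> \<sigma> \<in> UT n \<Longrightarrow> act_fract n \<sigma> a = a"
    and N: "\<And>i. i < n \<Longrightarrow> to_fract (orbit_norm i) \<in> K"
    and z: "z \<in> tower K n" "\<And>\<sigma>. \<sigma> \<in> UT n \<Longrightarrow> act_fract n \<sigma> z = z"
  shows "z \<in> K"
proof -
  let ?lin = "\<lambda>i. \<Prod>v\<in>to_fract ` (span_x i :: 'a mpoly set). [:- v, 1:]"
  let ?A = "\<lambda>i. ?lin i - [:to_fract (orbit_norm i):]"
  let ?S = "\<lambda>i. to_fract ` (\<lambda>v. Var (xv 0 i) + v) ` (span_x i :: 'a mpoly set)"
  have deg: "degree (?lin i) = CARD('a) ^ i" for i
    unfolding degree_prod_linear card_to_fract_image card_span_x ..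
  have degA: "degree (?A i) = CARD('a) ^ i" for i
  proof -
    have "degree (?lin i + - [:to_fract (orbit_norm i):]) = degree (?lin i)"
      by (rule degree_add_eq_left) (simp add: deg)
    thus ?thesis by (simp only: deg diff_conv_add_uminus)
  qed
  show ?thesis
  proof (rule tower_descent[where A = ?A and B = "\<lambda>_. 1" and S = ?S, OF UT_subset_GL K fixed _ _ _ _ _ _ _ _ z])
    fix i assume i: "i < n"
    note T = is_subring_tower[OF K, of i]
    note PT = is_subringD[OF is_subring_polys_over[OF T]]
    have "to_fract (orbit_norm i) \<in> tower K i" using N[OF i] tower_base[OF K] by blast
    thus "?A i \<in> polys_over (tower K i)"
      by (intro PT(3) prod_linear_polys_over[OF T span_x_subset_tower[OF K C]])
         (simp only: pCons_polys_over[OF T] PT(2) simp_thms)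
    show "1 \<in> polys_over (tower K i)" by (rule PT(1))
    have "Polynomial.coeff [:to_fract (orbit_norm i :: 'a mpoly):] (CARD('a) ^ i) = 0"
      using card_field_ge_2[where 'a='a] by (intro coeff_eq_0) simp
    thus "lead_coeff (?A i) = 1"
      using lead_coeff_prod_linear[of "to_fract ` (span_x i :: 'a mpoly set)"] unfolding degA deg by simp
    show "degree 1 < degree (?A i)" unfolding degA by simp
    show "card (?S i) = degree (?A i)" unfolding degA card_to_fract_image by (simp add: card_image card_span_x)
    fix s assume "s \<in> ?S i"
    then obtain u where u: "u \<in> span_x i" "s = to_fract (Var (xv 0 i) + u)" by auto
    have "poly (?lin i) s = (\<Prod>v\<in>span_x i. s - to_fract v)"
      by (simp add: poly_prod prod.reindex inj_on_def)
    also have "\<dots> = to_fract (orbit_norm i)"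
      unfolding orbit_norm_eq[OF u(1)] to_fract_prod by (simp add: u(2))
    finally show "poly (?A i) s = 0" by simp
    obtain c where "u = lin_x i c" using u(1) by (auto simp: span_x_def)
    thus "\<exists>\<sigma>\<in>UT n. (\<forall>a<i. act n \<sigma> (Var (xv 0 a)) = Var (xv 0 a)) \<and>
        to_fract (act n \<sigma> (Var (xv 0 i))) = s"
      using UT_move[OF i, of c] u(2) by auto
  qed (rule lead_coeff_1 | assumption)+
qed

section \<open>Reduction to the first copy\<close>

text \<open>
The descent hypothesis is used twice: for $D^{q-1}$, which then is an invertible element of the field,
and for an arbitrary invariant polynomial, which lies in the top ring of the tower once all
variables do.
\<close>

lemma invariant_field_eq_adjoin:
  fixes G :: "'a::{field,finite} mat set"
  assumes m: "m \<ge> 1" and G: "G \<subseteq> GL n" and S: "S \<subseteq> invariant_ring G n m d"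
    and moore_coordinate: "\<And>j r. 1 \<le> j \<Longrightarrow> j < m \<Longrightarrow> r < n \<Longrightarrow> moore_coordinate n j r \<in> S"
    and twisted_pairing: "\<And>k r. k < d \<Longrightarrow> r < n \<Longrightarrow> twisted_pairing n k r \<in> S"
    and descent: "\<And>z. z \<in> tower (adjoin S) n \<Longrightarrow> (\<And>\<sigma>. \<sigma> \<in> G \<Longrightarrow> act_fract n \<sigma> z = z) \<Longrightarrow> z \<in> adjoin S"
  shows "invariant_field G n m d = adjoin S"
proof
  show "adjoin S \<subseteq> invariant_field G n m d"
    using S G by (intro adjoin_minimal is_subfield_invariant_field to_fract_in_invariant_field
        Const_in_invariant_ring) auto
next
  let ?q = "CARD('a)" and ?K = "adjoin S" and ?x = "\<lambda>a. to_fract (Var (xv 0 a) :: 'a mpoly)"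
  have K: "is_subring ?K" by (rule is_subfieldD(1)[OF is_subfield_adjoin])
  note T = is_subringD[OF is_subring_tower[OF K, of n]]
  have base: "w \<in> tower ?K n" if "w \<in> ?K" for w using that tower_base[OF K] by blast
  have one_copy: "to_fract p \<in> tower ?K n" if "p \<in> poly_ring n 1 0" for p
    using poly_ring_subset_tower[OF K Const_in_adjoin that] .
  define D :: "'a mpoly" where "D = moore_det n"
  have "to_fract (D ^ (?q - 1)) \<in> tower ?K n"
    unfolding D_def by (intro one_copy is_subringD(7)[OF is_subring_poly_ring] moore_det_in_poly_ring)
  hence "to_fract (D ^ (?q - 1)) \<in> ?K"
  proof (rule descent)
    fix \<sigma> assume "\<sigma> \<in> G"
    hence "\<sigma> \<in> GL n" using G by auto
    thus "act_fract n \<sigma> (to_fract (D ^ (?q - 1))) = to_fract (D ^ (?q - 1))"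
      unfolding D_def by (simp only: act_fract_to_fract act_moore_det_power)
  qed
  hence D_inv: "inverse (to_fract (D ^ (?q - 1))) \<in> tower ?K n"
    by (intro base is_subfieldD(2)[OF is_subfield_adjoin])
  have D: "to_fract (D ^ (?q - 1)) \<noteq> 0" by (simp add: D_def moore_det_nonzero)
  have divide: "to_fract v \<in> tower ?K n" if "to_fract (D ^ (?q - 1) * v) \<in> tower ?K n" for v
  proof -
    have eq: "to_fract v = inverse (to_fract (D ^ (?q - 1))) * to_fract (D ^ (?q - 1) * v)"
      using D by simp
    show ?thesis unfolding eq by (rule T(4)[OF D_inv that])
  qed
  have x_in: "to_fract (Var (xv j a)) \<in> tower ?K n" if "j < m" "a < n" for j a
  proof (cases "j = 0")
    case True
    thus ?thesis using Var_in_tower[OF K that(2)] by simp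
  next
    case False
    show ?thesis
    proof (rule divide)
      have "to_fract (moore_coordinate n j r) \<in> tower ?K n" if "r < n" for r
        using moore_coordinate[of j r] False \<open>j < m\<close> that by (intro base in_adjoin) auto
      moreover have "?x a \<in> tower ?K n" using Var_in_tower[OF K that(2)] .
      ultimately show "to_fract (D ^ (?q - 1) * Var (xv j a)) \<in> tower ?K n"
        unfolding D_def moore_coordinate_relation[OF that(2), symmetric] to_fract_sum to_fract_mult to_fract_power
        by (intro T(4,7,8)) auto
    qed
  qed
  have y_in: "to_fract (Var (yv k b)) \<in> tower ?K n" if "k < d" "b < n" for k b
  proof (rule divide)
    have eq: "D ^ (?q - 1) * Var (yv k b) = D ^ (?q - 2) * (\<Sum>r<n. moore_adj n b r * twisted_pairing n k r)"
      unfolding twisted_pairing_relation[OF that(2)] D_def moore_det_powers[symmetric] by (simp only: mult.assoc)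
    have "to_fract D \<in> tower ?K n" unfolding D_def by (intro one_copy moore_det_in_poly_ring)
    moreover have "to_fract (moore_adj n b r) \<in> tower ?K n" if "r < n" for r
      using that \<open>b < n\<close> by (intro one_copy moore_adj_in_poly_ring)
    moreover have "to_fract (twisted_pairing n k r) \<in> tower ?K n" if "r < n" for r
      using that \<open>k < d\<close> by (intro base in_adjoin twisted_pairing)
    ultimately show "to_fract (D ^ (?q - 1) * Var (yv k b)) \<in> tower ?K n"
      unfolding eq to_fract_sum to_fract_mult to_fract_power by (intro T(4,7,8)) auto
  qed
  show "invariant_field G n m d \<subseteq> ?K"
  proof (rule invariant_field_subset[OF G is_subfield_adjoin])
    fix p assume p: "p \<in> invariant_ring G n m d"
    have "to_fract p \<in> tower ?K n"
    proof (rule poly_ring_subset_vimage[OF is_subring_tower[OF K]])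
      show "to_fract (Const c) \<in> tower ?K n" for c by (intro base Const_in_adjoin)
      show "to_fract (Var v) \<in> tower ?K n" if "v \<in> var_set n m d" for v
        using that x_in y_in by (auto simp: var_set_def)
      show "p \<in> poly_ring n m d" using p by (simp add: invariant_ring_def)
    qed
    thus "to_fract p \<in> ?K"
    proof (rule descent)
      fix \<sigma> assume "\<sigma> \<in> G"
      thus "act_fract n \<sigma> (to_fract p) = to_fract p"
        using p G by (auto simp: invariant_ring_def act_fract_to_fract subset_iff)
    qed
  qed
qed

section \<open>From the general to the special linear group\<close>

lemma of_nat_card_field: "of_nat (CARD('a::{field,finite})) = (0 :: 'a)"
  using binomial_card_finite_field[of 1, where 'a='a] card_field_ge_2[where 'a='a] by simp

lemma sum_powers_finite_field:
  fixes c :: "'a::{field,finite}"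
  assumes "c \<noteq> 0"
  shows "(\<Sum>k<CARD('a) - 1. c ^ k) = (if c = 1 then - 1 else 0)"
proof (cases "c = 1")
  case True
  have "of_nat (CARD('a) - 1) = (of_nat (CARD('a)) - 1 :: 'a)"
    using card_field_ge_2[where 'a='a] by (simp add: of_nat_diff)
  thus ?thesis using True by (simp add: of_nat_card_field)
next
  case False
  have "(1 - c) * (\<Sum>k<CARD('a) - 1. c ^ k) = 1 - c ^ (CARD('a) - 1)"
    by (rule one_diff_power_eq[symmetric])
  thus ?thesis using False finite_field_power_card_minus_1[OF assms] by simp
qed

text \<open>
Two matrices with the same determinant differ by a factor in \<open>SL\<close>.
\<close>

lemma act_fract_det_cong:
  fixes \<sigma> \<tau> :: "'a::{field,finite} mat"
  assumes z: "\<And>\<sigma>. \<sigma> \<in> SL n \<Longrightarrow> act_fract n \<sigma> z = z"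
    and st: "\<sigma> \<in> GL n" "\<tau> \<in> GL n" "det \<sigma> = det \<tau>"
  shows "act_fract n \<sigma> z = act_fract n \<tau> z"
proof -
  interpret R: ring "ring_mat TYPE('a) n ()" by (rule ring_mat)
  let ?s = "mat_inverse n \<tau> * \<sigma>"
  have U: "\<tau> \<in> Units (ring_mat TYPE('a) n ())" using st by (simp add: GL_Units)
  have car: "\<sigma> \<in> carrier_mat n n" "\<tau> \<in> carrier_mat n n" "mat_inverse n \<tau> \<in> carrier_mat n n"
    using R.Units_closed[OF U] R.Units_inv_closed[OF U] st by (simp_all add: ring_mat_simps GL_def)
  have inv: "\<tau> * mat_inverse n \<tau> = 1\<^sub>m n" "mat_inverse n \<tau> * \<tau> = 1\<^sub>m n"
    using R.Units_r_inv[OF U] R.Units_l_inv[OF U] by (simp_all add: ring_mat_simps)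
  have "det ?s = det (mat_inverse n \<tau>) * det \<tau>" using car st by (simp add: det_mult)
  also have "\<dots> = 1" using car inv(2) by (metis det_mult det_one)
  finally have s: "?s \<in> SL n" using car by (simp add: SL_def)
  have "\<tau> * ?s = (\<tau> * mat_inverse n \<tau>) * \<sigma>"
    using car by (simp add: assoc_mult_mat[of _ n n _ n _ n])
  hence eq: "\<tau> * ?s = \<sigma>" using car inv by simp
  have "?s \<in> GL n" using s SL_subset_GL by auto
  hence "act_fract n \<tau> (act_fract n ?s z) = act_fract n \<sigma> z"
    using act_fract_act_fract[of \<tau> n ?s z] st by (simp add: eq)
  thus ?thesis using z[OF s] by simp
qed

lemma act_fract_in_rat_field:
  assumes "\<sigma> \<in> GL n" "z \<in> rat_field n m d"
  shows "act_fract n \<sigma> z \<in> rat_field n m d"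
proof -
  obtain p r where pr: "z = to_fract p / to_fract r" "p \<in> poly_ring n m d" "r \<in> poly_ring n m d"
    using assms(2) by (auto simp: rat_field_eq)
  have "act_fract n \<sigma> z = to_fract (act n \<sigma> p) / to_fract (act n \<sigma> r)"
    unfolding pr(1) by (rule act_fract_divide[OF assms(1)])
  thus ?thesis using act_in_poly_ring[OF pr(2)] act_in_poly_ring[OF pr(3)] by (auto simp: rat_field_eq)
qed

text \<open>
Let $\tau_c$ be a diagonal matrix with determinant \<open>c\<close>. The image of an \<open>SL\<close>-invariant \<open>z\<close> under a
matrix depends on the determinant only, so $Z_k = \sum_{c \ne 0} c^{-k}\, \tau_c z$ is multiplied
by $\det(\sigma)^k$ under \<open>\<sigma>\<close>, just like $D^k$, and $Z_k / D^k$ is a \<open>GL\<close>-invariant. Summing over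
\<open>k < q - 1\<close> recovers $-z$, because $\sum_k c^{-k}$ is \<open>- 1\<close> for \<open>c = 1\<close> and vanishes
otherwise.
\<close>

lemma SL_field_from_GL_field:
  fixes K :: "'a::{field,finite} mpoly fract set"
  assumes n: "n \<ge> 1" "m \<ge> 1" and K: "is_subfield K" and GL: "invariant_field (GL n) n m d \<subseteq> K"
    and D: "to_fract (moore_det n) \<in> K"
  shows "invariant_field (SL n) n m d \<subseteq> K"
proof
  fix z assume "z \<in> invariant_field (SL n :: 'a mat set) n m d"
  hence z: "z \<in> rat_field n m d" "\<And>\<sigma> :: 'a mat. \<sigma> \<in> SL n \<Longrightarrow> act_fract n \<sigma> z = z"
    by (auto simp: invariant_field_def)
  let ?q = "CARD('a)" and ?C = "\<lambda>c. to_fract (Const (c :: 'a))" and ?U = "UNIV - {0 :: 'a}"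
  let ?D = "to_fract (moore_det n :: 'a mpoly)"
  define \<tau> :: "'a \<Rightarrow> 'a mat" where "\<tau> c = multrow_mat n 0 c" for c
  have \<tau>: "\<tau> c \<in> carrier_mat n n" "det (\<tau> c) = c" for c
    using n by (auto simp: \<tau>_def det_multrow_mat)
  have \<tau>_GL: "\<tau> c \<in> GL n" if "c \<noteq> 0" for c
    using det_non_zero_imp_unit[OF \<tau>(1), of c] \<tau>(2)[of c] that by (simp add: GL_Units)
  define Z where "Z k = (\<Sum>c\<in>?U. ?C (inverse c ^ k) * act_fract n (\<tau> c) z)" for k
  have R: "is_subring (rat_field n m d :: 'a mpoly fract set)" by (rule is_subfieldD(1)[OF is_subfield_rat_field])
  have Z_rat: "Z k \<in> rat_field n m d" for k
    unfolding Z_def using z(1) \<tau>_GL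
    by (intro is_subringD(4,8)[OF R] to_fract_in_rat_field Const_in_poly_ring act_fract_in_rat_field) auto
  have D_rat: "?D \<in> rat_field n m d"
    using poly_ring_mono[of 1 m 0 d n, where 'a='a] moore_det_in_poly_ring[of n, where 'a='a] n
    by (intro to_fract_in_rat_field) auto
  have D0: "?D \<noteq> 0" by (simp add: moore_det_nonzero)
  have act_Z: "act_fract n \<sigma> (Z k) = ?C (det \<sigma> ^ k) * Z k" if "\<sigma> \<in> GL n" for \<sigma> k
  proof -
    let ?e = "det \<sigma>"
    have car: "\<sigma> \<in> carrier_mat n n" using that by (simp add: GL_def)
    have e: "?e \<noteq> 0"
      using act_moore_det[OF car] act_eq_0_iff[OF that, of "moore_det n"] moore_det_nonzero[of n, where 'a='a]
      by (auto simp: Const_0)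
    have "act_fract n \<sigma> (Z k) = (\<Sum>c\<in>?U. ?C (inverse c ^ k) * act_fract n (\<tau> (?e * c)) z)"
      unfolding Z_def act_fract_sum[OF that]
    proof (intro sum.cong refl)
      fix c assume "c \<in> ?U"
      hence c: "\<tau> c \<in> GL n" "\<tau> (?e * c) \<in> GL n" using \<tau>_GL e by auto
      have "det (\<sigma> * \<tau> c) = det (\<tau> (?e * c))" using det_mult[OF car \<tau>(1)] \<tau>(2) by simp
      hence "act_fract n (\<sigma> * \<tau> c) z = act_fract n (\<tau> (?e * c)) z"
        using c that by (intro act_fract_det_cong z(2) GL_mult)
      thus "act_fract n \<sigma> (?C (inverse c ^ k) * act_fract n (\<tau> c) z) = ?C (inverse c ^ k) * act_fract n (\<tau> (?e * c)) z"
        using c that by (simp add: act_fract_mult act_fract_Const act_fract_act_fract GL_mult)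
    qed
    also have "\<dots> = (\<Sum>c\<in>?U. ?C (?e ^ k) * (?C (inverse c ^ k) * act_fract n (\<tau> c) z))"
    proof (rule sum.reindex_bij_witness[where i = "\<lambda>c. c / ?e" and j = "\<lambda>c. ?e * c"])
      fix c assume "c \<in> ?U"
      hence "?e * inverse (?e * c) = inverse c" using e by (simp add: field_simps)
      hence "?e ^ k * inverse (?e * c) ^ k = inverse c ^ k" by (simp only: flip: power_mult_distrib)
      hence "?C (?e ^ k) * ?C (inverse (?e * c) ^ k) = ?C (inverse c ^ k)"
        by (simp flip: to_fract_mult Const_mult)
      thus "?C (?e ^ k) * (?C (inverse (?e * c) ^ k) * act_fract n (\<tau> (?e * c)) z) =
          ?C (inverse c ^ k) * act_fract n (\<tau> (?e * c)) z"
        by (simp only: mult.assoc[symmetric])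
    qed (use e in auto)
    finally show ?thesis by (simp add: Z_def sum_distrib_left)
  qed
  have "Z k / ?D ^ k \<in> invariant_field (GL n) n m d" for k
    unfolding invariant_field_def
  proof (intro CollectI conjI ballI)
    show "Z k / ?D ^ k \<in> rat_field n m d"
      using Z_rat D_rat is_subringD(7)[OF R] by (intro is_subfieldD(3)[OF is_subfield_rat_field]) auto
    fix \<sigma> :: "'a mat" assume s: "\<sigma> \<in> GL n"
    have car: "\<sigma> \<in> carrier_mat n n" using s by (simp add: GL_def)
    have aD: "act_fract n \<sigma> ?D = ?C (det \<sigma>) * ?D"
      using act_moore_det[OF car] by (simp add: act_fract_to_fract[OF s])
    have e: "?C (det \<sigma>) \<noteq> 0"
      using act_moore_det[OF car] act_eq_0_iff[OF s, of "moore_det n"] moore_det_nonzero[of n, where 'a='a]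
      by auto
    have "act_fract n \<sigma> (Z k / ?D ^ k) = ?C (det \<sigma>) ^ k * Z k / (?C (det \<sigma>) * ?D) ^ k"
      unfolding divide_inverse act_fract_mult[OF s] act_fract_inverse[OF s] act_fract_power[OF s]
        act_Z[OF s] aD Const_power to_fract_power ..
    also have "\<dots> = Z k / ?D ^ k" using e by (simp add: power_mult_distrib)
    finally show "act_fract n \<sigma> (Z k / ?D ^ k) = Z k / ?D ^ k" .
  qed
  hence "Z k / ?D ^ k * ?D ^ k \<in> K" for k
    using GL D is_subringD(4,7)[OF is_subfieldD(1)[OF K]] by blast
  hence Z_K: "Z k \<in> K" for k using D0 by simp
  have "(\<Sum>k<?q - 1. Z k) = (\<Sum>c\<in>?U. ?C (\<Sum>k<?q - 1. inverse c ^ k) * act_fract n (\<tau> c) z)"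
    unfolding Z_def by (subst sum.swap) (simp add: Const_sum to_fract_sum sum_distrib_right)
  also have "\<dots> = (\<Sum>c\<in>?U. if c = 1 then - act_fract n (\<tau> c) z else 0)"
  proof (intro sum.cong refl)
    fix c assume "c \<in> ?U"
    moreover have "?C (- 1) = - 1"
      by (simp add: Const_uminus Const_1)
    ultimately show "?C (\<Sum>k<?q - 1. inverse c ^ k) * act_fract n (\<tau> c) z =
        (if c = 1 then - act_fract n (\<tau> c) z else 0)"
      using sum_powers_finite_field[of "inverse c"] by (simp add: Const_0)
  qed
  also have "\<dots> = - act_fract n (\<tau> 1) z" by simp
  also have "\<tau> 1 \<in> SL n" using \<tau>[of 1] by (simp add: SL_def)
  hence "act_fract n (\<tau> 1) z = z" by (rule z(2))
  finally have "z = - (\<Sum>k<?q - 1. Z k)" by simp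
  thus "z \<in> K" using Z_K by (simp add: is_subringD[OF is_subfieldD(1)[OF K]])
qed

section \<open>The generators\<close>

text \<open>
Block 0 belongs to the first copy of \<open>W\<close> and depends on the group, the blocks below \<open>m\<close> belong to
the other copies of \<open>W\<close>, and the last \<open>d\<close> blocks to the copies of the dual.
\<close>

definition generator :: "nat \<Rightarrow> nat \<Rightarrow> (nat \<Rightarrow> 'a::{field,finite} mpoly) \<Rightarrow> nat \<Rightarrow> nat \<Rightarrow> 'a mpoly" where
  "generator n m f b r = (if b = 0 then f r else if b < m then moore_coordinate n b r else twisted_pairing n (b - m) r)"

definition generators :: "nat \<Rightarrow> nat \<Rightarrow> nat \<Rightarrow> (nat \<Rightarrow> 'a::{field,finite} mpoly) \<Rightarrow> 'a mpoly set" where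
  "generators n m d f = {generator n m f b r |b r. b < m + d \<and> r < n}"

text \<open>
The index \<open>i\<close> starts at 1 and runs through the blocks one after the other, \<open>n\<close> generators in each.
\<close>

lemma generators_enumerated:
  assumes "n \<ge> 1"
  shows "(\<lambda>i. generator n m f ((i - 1) div n) ((i - 1) mod n)) ` {1..(m + d) * n} = generators n m d f"
    (is "?l ` _ = _")
proof
  show "?l ` {1..(m + d) * n} \<subseteq> generators n m d f"
  proof
    fix p assume "p \<in> ?l ` {1..(m + d) * n}"
    then obtain i where i: "i \<ge> 1" "i \<le> (m + d) * n" "p = ?l i" by auto
    have "(i - 1) div n < m + d" using i assms by (intro less_mult_imp_div_less) auto
    moreover have "(i - 1) mod n < n" using assms by simp
    ultimately show "p \<in> generators n m d f" using i(3) by (auto simp: generators_def)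
  qed
  show "generators n m d f \<subseteq> ?l ` {1..(m + d) * n}"
  proof
    fix p assume "p \<in> generators n m d f"
    then obtain b r where br: "b < m + d" "r < n" "p = generator n m f b r" by (auto simp: generators_def)
    have "b * n + r < Suc b * n" using br by simp
    also have "\<dots> \<le> (m + d) * n" using br by (intro mult_le_mono1) simp
    finally have "Suc (b * n + r) \<in> {1..(m + d) * n}" by simp
    moreover have "p = ?l (Suc (b * n + r))" using br by simp
    ultimately show "p \<in> ?l ` {1..(m + d) * n}" by blast
  qed
qed

lemma generators_invariant:
  fixes G :: "'a::{field,finite} mat set"
  assumes "m \<ge> 1" "G \<subseteq> GL n"
    and f: "\<And>r. r < n \<Longrightarrow> f r \<in> poly_ring n 1 0" "\<And>r \<sigma>. r < n \<Longrightarrow> \<sigma> \<in> G \<Longrightarrow> act n \<sigma> (f r) = f r"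
  shows "generators n m d f \<subseteq> invariant_ring G n m d"
proof
  fix p assume "p \<in> generators n m d f"
  then obtain b r where br: "b < m + d" "r < n" "p = generator n m f b r" by (auto simp: generators_def)
  have "f r \<in> poly_ring n m d" using f(1)[OF br(2)] poly_ring_mono[of 1 m 0 d n, where 'a='a] assms by auto
  hence "p \<in> poly_ring n m d"
    using br assms by (auto simp: generator_def intro!: moore_coordinate_in_poly_ring twisted_pairing_in_poly_ring)
  moreover have "act n \<sigma> p = p" if "\<sigma> \<in> G" for \<sigma>
  proof -
    have "\<sigma> \<in> GL n" using that assms by auto
    thus ?thesis using br that f(2) by (auto simp: generator_def act_moore_coordinate act_twisted_pairing)
  qed
  ultimately show "p \<in> invariant_ring G n m d" by (simp add: invariant_ring_def)
qed

lemma generators_members: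
  shows "m \<ge> 1 \<Longrightarrow> r < n \<Longrightarrow> f r \<in> generators n m d f"
    and "1 \<le> j \<Longrightarrow> j < m \<Longrightarrow> r < n \<Longrightarrow> moore_coordinate n j r \<in> generators n m d f"
    and "m \<ge> 1 \<Longrightarrow> k < d \<Longrightarrow> r < n \<Longrightarrow> twisted_pairing n k r \<in> generators n m d f"
proof -
  show "f r \<in> generators n m d f" if "m \<ge> 1" "r < n"
    using that unfolding generators_def by (intro CollectI exI[of _ 0] exI[of _ r]) (simp add: generator_def)
  show "moore_coordinate n j r \<in> generators n m d f" if "1 \<le> j" "j < m" "r < n"
    using that unfolding generators_def by (intro CollectI exI[of _ j] exI[of _ r]) (simp add: generator_def)
  show "twisted_pairing n k r \<in> generators n m d f" if "m \<ge> 1" "k < d" "r < n"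
    using that unfolding generators_def by (intro CollectI exI[of _ "m + k"] exI[of _ r]) (simp add: generator_def)
qed

lemma adjoin_fixed:
  assumes "G \<subseteq> GL n" "S \<subseteq> invariant_ring G n m d" "a \<in> adjoin S" "\<sigma> \<in> G"
  shows "act_fract n \<sigma> a = a"
proof -
  have "adjoin S \<subseteq> invariant_field G n m d"
    using assms by (intro adjoin_minimal is_subfield_invariant_field to_fract_in_invariant_field
        Const_in_invariant_ring) auto
  thus ?thesis using assms by (auto simp: invariant_field_def)
qed

lemma invariant_field_GL:
  assumes "m \<ge> 1"
  shows "generators n m d (dickson n) \<subseteq> (invariant_ring (GL n) n m d :: 'a::{field,finite} mpoly set)"
    "invariant_field (GL n) n m d = (adjoin (generators n m d (dickson n)) :: 'a mpoly fract set)"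
proof -
  let ?S = "generators n m d (dickson n) :: 'a mpoly set"
  show inv: "?S \<subseteq> invariant_ring (GL n) n m d"
    using assms by (intro generators_invariant dickson_in_poly_ring act_dickson) auto
  show "invariant_field (GL n) n m d = adjoin ?S"
  proof (rule invariant_field_eq_adjoin[OF assms subset_refl inv])
    fix z assume z: "z \<in> tower (adjoin ?S) n" "\<And>\<sigma>. \<sigma> \<in> GL n \<Longrightarrow> act_fract n \<sigma> z = z"
    show "z \<in> adjoin ?S"
    proof (rule GL_descent[OF is_subfieldD(1)[OF is_subfield_adjoin] Const_in_adjoin _ _ z])
      show "act_fract n \<sigma> a = a" if "a \<in> adjoin ?S" "\<sigma> \<in> GL n" for a \<sigma>
        by (rule adjoin_fixed[OF subset_refl inv that])
      show "to_fract (dickson n r) \<in> adjoin ?S" if "r < n" for r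
        using assms that by (intro in_adjoin generators_members(1))
    qed
  qed (use assms in \<open>auto intro: generators_members(2,3)\<close>)
qed

lemma invariant_field_UT:
  assumes "m \<ge> 1"
  shows "generators n m d orbit_norm \<subseteq> (invariant_ring (UT n) n m d :: 'a::{field,finite} mpoly set)"
    "invariant_field (UT n) n m d = (adjoin (generators n m d orbit_norm) :: 'a mpoly fract set)"
proof -
  let ?S = "generators n m d orbit_norm :: 'a mpoly set"
  show inv: "?S \<subseteq> invariant_ring (UT n) n m d"
    using assms by (intro generators_invariant UT_subset_GL orbit_norm_in_poly_ring act_orbit_norm) auto
  show "invariant_field (UT n) n m d = adjoin ?S"
  proof (rule invariant_field_eq_adjoin[OF assms UT_subset_GL inv])
    fix z assume z: "z \<in> tower (adjoin ?S) n" "\<And>\<sigma>. \<sigma> \<in> UT n \<Longrightarrow> act_fract n \<sigma> z = z"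
    show "z \<in> adjoin ?S"
    proof (rule UT_descent[OF is_subfieldD(1)[OF is_subfield_adjoin] Const_in_adjoin _ _ z])
      show "act_fract n \<sigma> a = a" if "a \<in> adjoin ?S" "\<sigma> \<in> UT n" for a \<sigma>
        by (rule adjoin_fixed[OF UT_subset_GL inv that])
      show "to_fract (orbit_norm r) \<in> adjoin ?S" if "r < n" for r
        using assms that by (intro in_adjoin generators_members(1))
    qed
  qed (use assms in \<open>auto intro: generators_members(2,3)\<close>)
qed

definition SL_first_copy :: "nat \<Rightarrow> nat \<Rightarrow> 'a::{field,finite} mpoly" where
  "SL_first_copy n r = (if r = 0 then moore_det n else dickson n r)"

lemma invariant_field_SL:
  assumes "n \<ge> 1" "m \<ge> 1"
  shows "generators n m d (SL_first_copy n) \<subseteq> (invariant_ring (SL n) n m d :: 'a::{field,finite} mpoly set)"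
    "invariant_field (SL n) n m d = (adjoin (generators n m d (SL_first_copy n)) :: 'a mpoly fract set)"
proof -
  let ?S = "generators n m d (SL_first_copy n) :: 'a mpoly set"
  let ?K = "adjoin ?S"
  show inv: "?S \<subseteq> invariant_ring (SL n) n m d"
  proof (rule generators_invariant[OF assms(2) SL_subset_GL])
    show "(SL_first_copy n r :: 'a mpoly) \<in> poly_ring n 1 0" for r
      by (simp add: SL_first_copy_def dickson_in_poly_ring moore_det_in_poly_ring del: One_nat_def)
    show "act n \<sigma> (SL_first_copy n r) = SL_first_copy n r" if "\<sigma> \<in> SL n" for \<sigma> :: "'a mat" and r
      using that SL_subset_GL[of n, where 'a='a]
      by (auto simp: SL_first_copy_def act_dickson SL_def act_moore_det Const_1 subset_iff)
  qed
  note K = is_subringD[OF is_subfieldD(1)[OF is_subfield_adjoin[of ?S]]]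
  have f: "to_fract (SL_first_copy n r) \<in> ?K" if "r < n" for r
    using that assms by (intro in_adjoin generators_members(1))
  have D: "to_fract (moore_det n) \<in> ?K" using f[of 0] assms by (simp add: SL_first_copy_def)
  have dickson: "to_fract (dickson n r) \<in> ?K" if "r < n" for r
  proof (cases "r = 0")
    case True
    show ?thesis unfolding True dickson_0[OF assms(1)] to_fract_mult to_fract_power
      using D K(1,5) by (intro K(4,7)) simp_all
  qed (use f[OF that] in \<open>simp add: SL_first_copy_def\<close>)
  have "adjoin (generators n m d (dickson n)) \<subseteq> ?K"
  proof (rule adjoin_minimal[OF is_subfield_adjoin Const_in_adjoin])
    fix p :: "'a mpoly" assume "p \<in> generators n m d (dickson n)"
    then obtain b r where br: "b < m + d" "r < n" "p = generator n m (dickson n) b r"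
      by (auto simp: generators_def)
    show "to_fract p \<in> ?K"
    proof (cases "b = 0")
      case True
      thus ?thesis using br dickson by (simp add: generator_def)
    next
      case False
      hence "p = generator n m (SL_first_copy n) b r" using br by (simp add: generator_def)
      thus ?thesis using br by (intro in_adjoin) (auto simp: generators_def)
    qed
  qed
  hence "invariant_field (GL n) n m d \<subseteq> ?K" by (simp add: invariant_field_GL(2)[OF assms(2)])
  from SL_field_from_GL_field[OF assms is_subfield_adjoin this D]
  have "invariant_field (SL n) n m d \<subseteq> ?K" .
  moreover have "?K \<subseteq> invariant_field (SL n) n m d"
    using inv SL_subset_GL[of n, where 'a='a] by (intro adjoin_minimal is_subfield_invariant_field
        to_fract_in_invariant_field Const_in_invariant_ring) auto
  ultimately show "invariant_field (SL n) n m d = ?K" by blast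
qed

theorem theorem1p2:
  fixes n m d :: nat and G :: "'a::{field,finite} mat set"
  assumes "n \<ge> 1" and "m \<ge> 1" and "d \<ge> 1"
    and "G \<in> {GL n, SL n, UT n}"
  shows "\<exists>l :: nat \<Rightarrow> 'a mpoly.
    (\<forall>i\<in>{1..(m + d) * n}. l i \<in> invariant_ring G n m d) \<and>
    invariant_field G n m d = adjoin (l ` {1..(m + d) * n})"
proof -
  consider "G = GL n" | "G = SL n" | "G = UT n" using assms(4) by auto
  then obtain f :: "nat \<Rightarrow> 'a mpoly" where
    f: "generators n m d f \<subseteq> invariant_ring G n m d" "invariant_field G n m d = adjoin (generators n m d f)"
  proof cases
    case 1
    show ?thesis by (rule that[of "dickson n"]) (simp_all only: 1 invariant_field_GL[OF assms(2)])
  next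
    case 2
    show ?thesis by (rule that[of "SL_first_copy n"]) (simp_all only: 2 invariant_field_SL[OF assms(1,2)])
  next
    case 3
    show ?thesis by (rule that[of orbit_norm]) (simp_all only: 3 invariant_field_UT[OF assms(2)])
  qed
  let ?l = "\<lambda>i. generator n m f ((i - 1) div n) ((i - 1) mod n)"
  note l = generators_enumerated[OF assms(1), of m f d]
  show ?thesis
  proof (intro exI[of _ ?l] conjI ballI)
    show "invariant_field G n m d = adjoin (?l ` {1..(m + d) * n})" unfolding l by (rule f(2))
    fix i assume "i \<in> {1..(m + d) * n}"
    hence "?l i \<in> generators n m d f" unfolding l[symmetric] by (rule imageI)
    thus "?l i \<in> invariant_ring G n m d" using f(1) by blast
  qed
qed

end
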